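(* Let $d \ge 1$, $\alpha \in (0,1)$, and let $c_{\alpha,d} > 0$ be a constant such that $$\mathbb{P}\bigl( \|\hat{P}_n - P\|_{\mathcal{H}} \ge n^{-1/2} c_{\alpha,d} \bigr) \le \alpha$$ for every probability distribution $P$ on $\mathbb{R}^d$ and every $n \ge 1$, where $\hat{P}_n$ is the empirical distribution of independent random vectors $X_1, \ldots, X_n \sim P$. For $n \ge 1$ define $$C_{\alpha,n} := \bigl\{ Q \in \mathcal{P}_d^{(\mathrm{lc})} : \|Q - \hat{P}_n\|_{\mathcal{H}} \le n^{-1/2} c_{\alpha,d} \bigr\},$$ and for every polynomial $\Pi : \mathbb{R}^d \to \mathbb{R}$ define $$C_{\alpha,n}^{(\Pi)} := \Bigl\{ \int \Pi(x)\, Q(dx) : Q \in C_{\alpha,n} \Bigr\}.$$ Suppose that $P \in \mathcal{P}_d^{(\mathrm{lc})}$ and that $X_1, X_2, \ldots$ are independent with distribution $P$. Then the sets $C_{\alpha,n}^{(\Pi)}$ are simultaneous $(1-\alpha)$-confidence sets for all the integrals $\int \Pi(x)\,P(dx)$, i.e. for every $n \ge 1$, $$\mathbb{P}\Bigl( \int \Pi(x)\, P(dx) \in C_{\alpha,n}^{(\Pi)} \text{ for all polynomials } \Pi : \mathbb{R}^d \to \mathbb{R} \Bigr) \ge 1 - \alpha,$$ and they are consistent in the sense that for every polynomial $\Pi : \mathbb{R}^d \to \mathbb{R}$, $$\sup_{t \in C_{\alpha,n}^{(\Pi)}} \Bigl| t - \int \Pi(x)\, P(dx) \Bigr| \to_p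 0 \quad\text{as } n \to \infty.$$
   Context: $\mathcal{P}_d^{(\mathrm{lc})}$ denotes the set of all log-concave probability distributions on $\mathbb{R}^d$, i.e. all probability measures admitting a Lebesgue density of the form $f(x) = \exp(\varphi(x))$ for some concave function $\varphi : \mathbb{R}^d \to [-\infty,\infty)$ (with $\exp(-\infty)=0$). $\mathcal{H}$ denotes the set of all closed halfspaces in $\mathbb{R}^d$, and for probability measures $P, Q$ on $\mathbb{R}^d$, $\|P - Q\|_{\mathcal{H}} := \sup_{H \in \mathcal{H}} |P(H) - Q(H)|$. The empirical distribution of $X_1,\ldots,X_n$ is $\hat{P}_n = n^{-1}\sum_{i=1}^n \delta_{X_i}$. It is known from empirical process theory that a constant $c_{\alpha,d}$ with the required property exists for every $\alpha \in (0,1)$ and $d \ge 1$. $\to_p$ denotes convergence in probability. The supremum over the empty set is read as $0$; should measurability be an issue, the coverage probability is read as an inner probability and convergence in probability is read in terms of outer probability. *)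

theory Defs
  imports "HOL-Probability.Probability"
begin

definition closed_halfspaces :: "'a::euclidean_space set set" where
  "closed_halfspaces = {H. \<exists>a b. a \<noteq> 0 \<and> H = {x. a \<bullet> x \<le> b}}"

definition halfspace_dist :: "'a::euclidean_space measure \<Rightarrow> 'a measure \<Rightarrow> real" where
  "halfspace_dist P Q = (SUP H\<in>closed_halfspaces. \<bar>measure P H - measure Q H\<bar>)"

(* The weights are strictly between 0 and 1, so the ereal conventions for
   0 * (-\<infinity>) play no role; as the value \<infinity> is excluded, no sum \<infinity> + (-\<infinity>) arises. *)
definition ereal_concave :: "('a::real_vector \<Rightarrow> ereal) \<Rightarrow> bool" where
  "ereal_concave \<phi> \<longleftrightarrow> (\<forall>x. \<phi> x \<noteq> \<infinity>) \<and>
     (\<forall>x y t. 0 < t \<and> t < 1 \<longrightarrow>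
        ereal (1 - t) * \<phi> x + ereal t * \<phi> y \<le> \<phi> ((1 - t) *\<^sub>R x + t *\<^sub>R y))"

(* Meant for arguments in [-\<infinity>, \<infinity>). *)
definition exp_ereal :: "ereal \<Rightarrow> real" where
  "exp_ereal u = (if u = -\<infinity> then 0 else exp (real_of_ereal u))"

(* Distributions live on the Borel sets; the density is only required to be
   Lebesgue measurable, since a concave function with values in [-\<infinity>, \<infinity>) need not be
   Borel measurable on the boundary of its effective domain. *)
definition log_concave_distributions :: "'a::euclidean_space measure set" where
  "log_concave_distributions = {Q. prob_space Q \<and> sets Q = sets borel \<and>
     (\<exists>\<phi>. ereal_concave \<phi> \<and>
          (\<lambda>x. exp_ereal (\<phi> x)) \<in> borel_measurable lebesgue \<and>
          (\<forall>B\<in>sets borel. emeasure Q B =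
             (\<integral>\<^sup>+ x\<in>B. ennreal (exp_ereal (\<phi> x)) \<partial>lebesgue)))}"

definition empirical_distribution :: "nat \<Rightarrow> (nat \<Rightarrow> 'a::euclidean_space) \<Rightarrow> 'a measure" where
  "empirical_distribution n x =
     measure_of UNIV (sets borel) (\<lambda>A. (\<Sum>i<n. emeasure (return borel (x i)) A) / of_nat n)"

definition confidence_set ::
    "real \<Rightarrow> nat \<Rightarrow> (nat \<Rightarrow> 'a::euclidean_space) \<Rightarrow> 'a measure set" where
  "confidence_set c n x =
     {Q \<in> log_concave_distributions.
        halfspace_dist Q (empirical_distribution n x) \<le> c / sqrt (real n)}"

definition integral_confidence_set ::
    "real \<Rightarrow> nat \<Rightarrow> (nat \<Rightarrow> 'a::euclidean_space) \<Rightarrow> ('a \<Rightarrow> real) \<Rightarrow> real set" where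
  "integral_confidence_set c n x p = {(\<integral>y. p y \<partial>Q) | Q. Q \<in> confidence_set c n x}"

definition inner_measure_of :: "'a measure \<Rightarrow> 'a set \<Rightarrow> ennreal" where
  "inner_measure_of M A = (SUP B\<in>{B \<in> sets M. B \<subseteq> A}. emeasure M B)"

(* Convergence in probability to 0 of [0, \<infinity>]-valued maps, in terms of outer probability. *)
definition tends_to_0_in_outer_prob :: "'w measure \<Rightarrow> (nat \<Rightarrow> 'w \<Rightarrow> ennreal) \<Rightarrow> bool" where
  "tends_to_0_in_outer_prob M Y \<longleftrightarrow>
     (\<forall>\<epsilon>::real. \<epsilon> > 0 \<longrightarrow>
        (\<lambda>n. outer_measure_of M {\<omega> \<in> space M. Y n \<omega> > ennreal \<epsilon>}) \<longlonglongrightarrow> 0)"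

lemma sets_empirical_distribution [simp]: "sets (empirical_distribution n x) = sets borel"
  unfolding empirical_distribution_def
  using sets.sigma_sets_eq[of "borel :: 'a measure"] by (simp add: sets_measure_of_conv)

lemma emeasure_empirical_distribution:
  assumes "A \<in> sets borel"
  shows "emeasure (empirical_distribution n x) A
         = (\<Sum>i<n. emeasure (return borel (x i)) A) / of_nat n"
proof (rule emeasure_measure_of[OF empirical_distribution_def])
  show "sets borel \<subseteq> Pow (UNIV :: 'a set)" by simp
  show "A \<in> sets (empirical_distribution n x)" using assms by simp
  show "positive (sets (empirical_distribution n x))
          (\<lambda>A. (\<Sum>i<n. emeasure (return borel (x i)) A) / of_nat n)"
    by (simp add: positive_def)
  show "countably_additive (sets (empirical_distribution n x))
          (\<lambda>A. (\<Sum>i<n. emeasure (return borel (x i)) A) / of_nat n)"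
  proof (rule countably_additiveI)
    fix B :: "nat \<Rightarrow> 'a set"
    assume B: "range B \<subseteq> sets (empirical_distribution n x)" "disjoint_family B"
    have "(\<Sum>k. (\<Sum>i<n. emeasure (return borel (x i)) (B k)) / of_nat n)
        = (\<Sum>k. \<Sum>i<n. emeasure (return borel (x i)) (B k)) / of_nat n"
      by (simp add: divide_ennreal_def)
    also have "\<dots> = (\<Sum>i<n. \<Sum>k. emeasure (return borel (x i)) (B k)) / of_nat n"
      by (subst suminf_sum) auto
    also have "\<dots> = (\<Sum>i<n. emeasure (return borel (x i)) (\<Union>k. B k)) / of_nat n"
      using B by (intro arg_cong2[where f = "(/)"] sum.cong refl suminf_emeasure) auto
    finally show "(\<Sum>k. (\<Sum>i<n. emeasure (return borel (x i)) (B k)) / of_nat n)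
        = (\<Sum>i<n. emeasure (return borel (x i)) (\<Union>k. B k)) / of_nat n" .
  qed
qed

end

(* Every polynomial is a linear combination of powers of linear forms u . x, so only one-dimensional
   marginals matter, and these are governed by halfspace probabilities. By the Prekopa-Leindler
   inequality, S t = Q {x. t <= u . x} satisfies S s * S t <= (S ((s + t) / 2))^2 for log-concave Q;
   hence as soon as Q puts mass at least 3/4 above -t, and at most 1/4 above t, its tails decay geometrically
   at a rate depending on t only. Moments of log-concave distributions are therefore continuous
   functionals for the topology of pointwise convergence on closed halfspaces, and consistency needs
   the law of large numbers (Hoeffding) only for finitely many halfspaces rather than uniformly. *)
theory Submission
  imports Defs
begin

text \<open>Coverage is simultaneous because one event serves all polynomials: the event that
  \<open>P\<close> itself lies in the confidence set. Consistency is the harder half, since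
  polynomials are unbounded and, for general distributions, closeness on halfspaces does not control
  their integrals: a tiny mass far away can shift a moment arbitrarily. Geometric tails supply the
  missing uniform integrability. The thresholds 3/4 and 1/4 are complementary, so one event of
  probability below 1/4 yields both, and their quotient 1/3 is the rate of decay. Prekopa-Leindler
  is stated for midpoints only, with a square in place of a square root; this suffices because tails
  are inspected along an arithmetic progression.\<close>

section \<open>The Prekopa-Leindler inequality\<close>

text \<open>Brunn-Minkowski below averages one set with a point at the end of the other, but a
  supremum may be infinite or not attained; the points \<open>a n\<close> of \<open>A\<close> stand
  in for it. A point of \<open>A\<close> that no \<open>a n\<close> exceeds must be the maximum of
  \<open>A\<close>, so a single \<open>m\<close> covers the rest.\<close>

lemma incseq_cofinal_in_real_set:
  fixes A :: "real set"
  assumes "A \<noteq> {}"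
  obtains a :: "nat \<Rightarrow> real" and m where "incseq a" "\<And>n. a n \<in> A"
    "A \<subseteq> insert m (\<Union>n. {..<a n})"
proof -
  obtain f :: "nat \<Rightarrow> ereal" where f: "incseq f" "range f \<subseteq> ereal ` A" "Sup (ereal ` A) = (SUP i. f i)"
    using Sup_countable_SUP[of "ereal ` A"] assms by auto
  define a where "a n = real_of_ereal (f n)" for n
  have fa: "f n = ereal (a n)" and aA: "a n \<in> A" for n
    using f(2) unfolding a_def by (auto simp: image_subset_iff image_iff) (metis real_of_ereal.simps(1))+
  have inc: "incseq a" using f(1) by (simp add: incseq_def fa)
  have top: "a n \<le> x" if "x \<in> A" "x \<notin> (\<Union>n. {..<a n})" for x n
    using that by (auto simp: not_less)
  have "x = y" if x: "x \<in> A" "x \<notin> (\<Union>n. {..<a n})" and y: "y \<in> A" "y \<notin> (\<Union>n. {..<a n})" for x y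
  proof -
    have *: "u \<le> v" if u: "u \<in> A" and v: "\<And>n. a n \<le> v" for u v
    proof -
      have "ereal u \<le> Sup (ereal ` A)" using u by (auto intro: Sup_upper)
      also have "\<dots> \<le> ereal v" unfolding f(3) by (rule SUP_least) (simp add: fa v)
      finally show ?thesis by simp
    qed
    show ?thesis using *[OF x(1) top[OF y]] *[OF y(1) top[OF x]] by simp
  qed
  then obtain m where "A \<subseteq> insert m (\<Union>n. {..<a n})" by blast
  then show thesis using that inc aA by blast
qed

text \<open>The one point that the truncations may miss is a null set.\<close>

lemma emeasure_lborel_cofinal:
  fixes A :: "real set"
  assumes A: "A \<in> sets borel" and a: "incseq a" "A \<subseteq> insert m (\<Union>n. {..<a n})"
  shows "emeasure lborel A = (SUP n. emeasure lborel (A \<inter> {..<a n}))"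
proof -
  have "(SUP n. emeasure lborel (A \<inter> {..<a n})) = emeasure lborel (\<Union>n. A \<inter> {..<a n})"
    using A a(1) by (intro SUP_emeasure_incseq) (auto simp: incseq_def intro: less_le_trans)
  also have "\<dots> = emeasure lborel A"
  proof (rule emeasure_eq_AE)
    show "AE x in lborel. (x \<in> (\<Union>n. A \<inter> {..<a n})) = (x \<in> A)"
      using AE_lborel_singleton[of m] by eventually_elim (use a(2) in auto)
  qed (use A in auto)
  finally show ?thesis by simp
qed

text \<open>The set on the right consists of the midpoints of \<open>b\<close> with the points of
  \<open>A\<close>, hence the factor 2. Written as a preimage it is Borel at once.\<close>

lemma emeasure_lborel_midpoint_slice:
  fixes A :: "real set"
  assumes [measurable]: "A \<in> sets borel"
  shows "emeasure lborel A = 2 * emeasure lborel {z. 2 * z - b \<in> A}"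
proof -
  have "emeasure lborel A = (\<integral>\<^sup>+x. indicator A x \<partial>lborel)" by simp
  also have "\<dots> = \<bar>2::real\<bar> * (\<integral>\<^sup>+x. indicator A (- b + 2 * x) \<partial>lborel)"
    by (rule nn_integral_real_affine) auto
  also have "(\<lambda>x. indicator A (- b + 2 * x)) = (indicator {z. 2 * z - b \<in> A} :: real \<Rightarrow> ennreal)"
    by (auto simp: fun_eq_iff indicator_def algebra_simps)
  also have "(\<integral>\<^sup>+x. indicator {z. 2 * z - b \<in> A} x \<partial>lborel) = emeasure lborel {z. 2 * z - b \<in> A}"
    by (rule nn_integral_indicator) measurable
  finally show ?thesis by simp
qed

text \<open>If \<open>A\<close> ended at a point a of \<open>A\<close> and \<open>B\<close> began at
  a point b of \<open>B\<close>, the midpoints of \<open>A\<close> with b and of a with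
  \<open>B\<close> would lie in \<open>C\<close>, on opposite sides of (a + b) / 2, with half the
  lengths of \<open>A\<close> and \<open>B\<close>. Truncation reduces the general case to this one.
  \<open>C\<close> is any Borel set containing the midpoints, as the set of all midpoints may fail
  to be Borel.\<close>

lemma brunn_minkowski_real:
  fixes A B C :: "real set"
  assumes [measurable]: "A \<in> sets borel" "B \<in> sets borel" "C \<in> sets borel"
    and ne: "A \<noteq> {}" "B \<noteq> {}"
    and C: "\<And>a b. a \<in> A \<Longrightarrow> b \<in> B \<Longrightarrow> (a + b) / 2 \<in> C"
  shows "emeasure lborel A + emeasure lborel B \<le> 2 * emeasure lborel C"
proof -
  let ?\<mu> = "emeasure lborel"
  obtain a m where a: "incseq a" "\<And>n. a n \<in> A" "A \<subseteq> insert m (\<Union>n. {..<a n})"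
    using incseq_cofinal_in_real_set[OF ne(1)] by blast
  \<comment> \<open>The left end of \<open>B\<close> is reached as the right end of its reflection,
    so the points of \<open>B\<close> in use are \<open>- b n\<close>.\<close>
  obtain b k where b: "incseq b" "\<And>n. b n \<in> uminus ` B" "uminus ` B \<subseteq> insert k (\<Union>n. {..<b n})"
    using incseq_cofinal_in_real_set[of "uminus ` B"] ne(2) by auto
  have bB: "- b n \<in> B" for n using b(2)[of n] by auto
  define B' where "B' = uminus -` B"
  have B'[measurable]: "B' \<in> sets borel"
    unfolding B'_def by (rule measurable_sets_borel[of _ borel]) auto
  have B'_eq: "B' = uminus ` B" by (force simp: B'_def)
  have refl: "?\<mu> (uminus -` S) = ?\<mu> S" if [measurable]: "S \<in> sets borel" for S :: "real set"
    by (subst (2) lborel_distr_uminus[symmetric]) (simp add: emeasure_distr)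
  have step: "?\<mu> (A \<inter> {..<a n}) + ?\<mu> (B' \<inter> {..<b n}) \<le> 2 * ?\<mu> C" for n
  proof -
    \<comment> \<open>The truncations are strict, so \<open>?A\<close> lies to the left and
      \<open>?B\<close> to the right of \<open>(a n - b n) / 2\<close>, and their lengths
      add.\<close>
    let ?A = "{z. 2 * z - (- b n) \<in> A \<inter> {..<a n}}" and ?B = "{z. 2 * z - a n \<in> B \<inter> {- b n<..}}"
    have "B' \<inter> {..<b n} = uminus -` (B \<inter> {- b n<..})" by (auto simp: B'_def)
    then have "?\<mu> (B' \<inter> {..<b n}) = ?\<mu> (B \<inter> {- b n<..})" using refl[of "B \<inter> {- b n<..}"] by simp
    then have "?\<mu> (A \<inter> {..<a n}) + ?\<mu> (B' \<inter> {..<b n}) = 2 * ?\<mu> ?A + 2 * ?\<mu> ?B"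
      using emeasure_lborel_midpoint_slice[of "A \<inter> {..<a n}" "- b n"]
        emeasure_lborel_midpoint_slice[of "B \<inter> {- b n<..}" "a n"] by simp
    also have "\<dots> = 2 * (?\<mu> ?A + ?\<mu> ?B)" by (simp add: distrib_left)
    also have "?\<mu> ?A + ?\<mu> ?B = ?\<mu> (?A \<union> ?B)"
      by (rule plus_emeasure) (measurable, auto)
    also have "?\<mu> (?A \<union> ?B) \<le> ?\<mu> C"
    proof (rule emeasure_mono)
      show "?A \<union> ?B \<subseteq> C"
      proof
        fix z assume "z \<in> ?A \<union> ?B"
        then show "z \<in> C" using C[of "2 * z + b n" "- b n"] C[of "a n" "2 * z - a n"] a(2)[of n] bB[of n]
          by auto
      qed
    qed simp
    finally show ?thesis by (simp add: mult_left_mono)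
  qed
  have "?\<mu> A + ?\<mu> B = ?\<mu> A + ?\<mu> B'" using refl[of B] by (simp add: B'_def)
  also have "\<dots> = (SUP n. ?\<mu> (A \<inter> {..<a n})) + (SUP n. ?\<mu> (B' \<inter> {..<b n}))"
    using emeasure_lborel_cofinal[OF _ a(1,3)] emeasure_lborel_cofinal[OF B' b(1), of k] b(3)
    by (simp add: B'_eq)
  also have "\<dots> = (SUP n. ?\<mu> (A \<inter> {..<a n}) + ?\<mu> (B' \<inter> {..<b n}))"
    using a(1) b(1)
    by (intro ennreal_SUP_add[symmetric]) (auto simp: incseq_def intro!: emeasure_mono intro: less_le_trans)
  also have "\<dots> \<le> 2 * ?\<mu> C" by (rule SUP_least) (rule step)
  finally show ?thesis .
qed

section \<open>From level sets to integrals: the inequality in dimension one\<close>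

text \<open>Each value is the length of the set of positive levels below it; then the integrals are
  exchanged. Negative levels must be cut off: \<open>ennreal\<close> sends them to 0, so each would
  count the whole set where \<open>f\<close> is positive.\<close>

lemma nn_integral_layer_cake:
  fixes f :: "'a \<Rightarrow> ennreal"
  assumes "sigma_finite_measure M" and [measurable]: "f \<in> borel_measurable M"
  shows "(\<integral>\<^sup>+x. f x \<partial>M) = (\<integral>\<^sup>+t. indicator {0<..} t * emeasure M {x \<in> space M. ennreal t < f x} \<partial>lborel)"
proof -
  interpret sigma_finite_measure M by fact
  interpret pair_sigma_finite M "lborel :: real measure" ..
  have f: "y = (\<integral>\<^sup>+t. indicator {0<..} t * indicator {t. ennreal t < y} t \<partial>lborel)" for y :: ennreal
  proof (cases y)
    case (real r)
    have "(\<integral>\<^sup>+t. indicator {0<..} t * indicator {t. ennreal t < y} t \<partial>lborel) = (\<integral>\<^sup>+t. indicator {0<..<r} t \<partial>lborel)"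
      using real by (intro nn_integral_cong) (auto simp: indicator_def ennreal_less_iff)
    then show ?thesis using real by simp
  next
    case top
    have "(\<integral>\<^sup>+t. indicator {0<..} t * indicator {t. ennreal t < y} t \<partial>lborel) = (\<integral>\<^sup>+t. indicator {0<..} (t::real) \<partial>lborel)"
      using top by (intro nn_integral_cong) (auto simp: indicator_def)
    moreover have "emeasure lborel {0::real<..} = top"
    proof (rule ccontr)
      assume "emeasure lborel {0::real<..} \<noteq> top"
      then obtain n where "emeasure lborel {0::real<..} < of_nat n"
        using ennreal_Ex_less_of_nat by (auto simp: top.not_eq_extremum)
      moreover have "of_nat n \<le> emeasure lborel {0::real<..}"
      proof -
        have "emeasure lborel {0<..<real n} \<le> emeasure lborel {0::real<..}"
          by (intro emeasure_mono) auto
        then show ?thesis by (simp add: ennreal_of_nat_eq_real_of_nat)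
      qed
      ultimately show False by simp
    qed
    ultimately show ?thesis using top by simp
  qed
  have "(\<integral>\<^sup>+x. f x \<partial>M) = (\<integral>\<^sup>+x. (\<integral>\<^sup>+t. indicator {0<..} t * indicator {t. ennreal t < f x} t \<partial>lborel) \<partial>M)"
    by (subst f) simp
  also have "\<dots> = (\<integral>\<^sup>+t. (\<integral>\<^sup>+x. indicator {0<..} t * indicator {t. ennreal t < f x} t \<partial>M) \<partial>lborel)"
    by (rule Fubini'[symmetric]) (simp add: indicator_def, measurable)
  also have "\<dots> = (\<integral>\<^sup>+t. indicator {0<..} t * emeasure M {x \<in> space M. ennreal t < f x} \<partial>lborel)"
  proof (rule nn_integral_cong)
    fix t :: real
    have "(\<integral>\<^sup>+x. indicator {0<..} t * indicator {t. ennreal t < f x} t \<partial>M)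
       = (\<integral>\<^sup>+x. indicator {0<..} t * indicator {x \<in> space M. ennreal t < f x} x \<partial>M)"
      by (intro nn_integral_cong) (auto simp: indicator_def)
    then show "(\<integral>\<^sup>+x. indicator {0<..} t * indicator {t. ennreal t < f x} t \<partial>M)
       = indicator {0<..} t * emeasure M {x \<in> space M. ennreal t < f x}"
      by (simp add: nn_integral_cmult)
  qed
  finally show ?thesis .
qed

text \<open>The arithmetic-geometric mean inequality without roots; it turns the additive bound
  coming from Brunn-Minkowski into one for a product of integrals.\<close>

lemma ennreal_four_mult_le_add_square: "4 * (a * b) \<le> (a + b)\<^sup>2" for a b :: ennreal
proof (cases "a = top \<or> b = top")
  case True
  then show ?thesis by (auto simp: power2_eq_square ennreal_mult_top ennreal_top_mult)
next
  case False
  then obtain x y where "a = ennreal x" "b = ennreal y" "0 \<le> x" "0 \<le> y" by (metis ennreal_cases)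
  moreover have "4 * (x * y) \<le> (x + y)\<^sup>2"
    using sum_squares_bound[of x y] by (simp add: power2_eq_square algebra_simps)
  ultimately show ?thesis
    by (simp add: ennreal_power ennreal_leI flip: ennreal_mult ennreal_plus ennreal_numeral)
qed

text \<open>Here \<open>m\<close> is the supremum of \<open>f\<close> as a positive real, by which
  \<open>f\<close> is later normalized.\<close>

lemma ennreal_Sup_bounded:
  fixes f :: "'a \<Rightarrow> ennreal"
  assumes "\<And>x. f x \<le> ennreal r" "\<exists>x. f x \<noteq> 0"
  obtains m where "m > 0" "\<And>x. f x \<le> ennreal m" "\<And>s. s < m \<Longrightarrow> 0 \<le> s \<Longrightarrow> \<exists>x. ennreal s < f x"
proof -
  have "(SUP x. f x) \<le> ennreal r" using assms(1) by (rule SUP_least)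
  then obtain m where m: "(SUP x. f x) = ennreal m" "0 \<le> m"
    by (metis ennreal_cases ennreal_less_top leD)
  have le: "f x \<le> ennreal m" for x unfolding m(1)[symmetric] by (rule SUP_upper) simp
  obtain x where "f x \<noteq> 0" using assms(2) by blast
  then have "m > 0" using le[of x] m(2) by (cases "m = 0") auto
  moreover have "\<exists>x. ennreal s < f x" if "s < m" "0 \<le> s" for s
  proof -
    have "ennreal s < (SUP x. f x)" using that m by (simp add: ennreal_less_iff)
    then show ?thesis by (simp add: less_SUP_iff)
  qed
  ultimately show thesis using that le by blast
qed

text \<open>Brunn-Minkowski needs both sets nonempty. With both suprema equal to 1, the level sets
  of \<open>f\<close> and \<open>g\<close> are nonempty for all t in (0, 1) and empty for t \<ge> 1.
  If \<open>f\<close> at a and \<open>g\<close> at b exceed t, so does \<open>h\<close> at the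
  midpoint; integrating the resulting bound on lengths over t gives an inequality between sums of
  integrals.\<close>

lemma prekopa_leindler_real_normalized:
  fixes f g h :: "real \<Rightarrow> ennreal"
  assumes [measurable]: "f \<in> borel_measurable borel" "g \<in> borel_measurable borel" "h \<in> borel_measurable borel"
    and le: "\<And>x y. f x * g y \<le> (h ((x + y) / 2))\<^sup>2"
    and f1: "\<And>x. f x \<le> 1" "\<And>s. s < 1 \<Longrightarrow> 0 \<le> s \<Longrightarrow> \<exists>x. ennreal s < f x"
    and g1: "\<And>x. g x \<le> 1" "\<And>s. s < 1 \<Longrightarrow> 0 \<le> s \<Longrightarrow> \<exists>x. ennreal s < g x"
  shows "(\<integral>\<^sup>+x. f x \<partial>lborel) * (\<integral>\<^sup>+x. g x \<partial>lborel) \<le> (\<integral>\<^sup>+x. h x \<partial>lborel)\<^sup>2"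
proof -
  let ?I = "\<lambda>f. \<integral>\<^sup>+x. f x \<partial>lborel" and ?L = "\<lambda>f t. emeasure lborel {x. ennreal t < f x}"
  have level: "indicator {0<..} t * ?L f t + indicator {0<..} t * ?L g t \<le> 2 * (indicator {0<..} t * ?L h t)"
    for t :: real
  proof (cases "0 < t \<and> t < 1")
    case True
    have "?L f t + ?L g t \<le> 2 * ?L h t"
    proof (rule brunn_minkowski_real)
      fix a b assume "a \<in> {x. ennreal t < f x}" "b \<in> {x. ennreal t < g x}"
      then have t: "ennreal t < f a" "ennreal t < g b" by auto
      have "ennreal t * ennreal t < ennreal t * g b"
        using t True by (intro ennreal_mult_strict_left_mono) auto
      also have "\<dots> \<le> f a * g b" using t by (intro mult_right_mono) auto
      also have "\<dots> \<le> (h ((a + b) / 2))\<^sup>2" by (rule le)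
      finally have "\<not> h ((a + b) / 2) \<le> ennreal t"
        using power_mono[of "h ((a + b) / 2)" "ennreal t" 2] by (auto simp: power2_eq_square)
      then show "(a + b) / 2 \<in> {x. ennreal t < h x}" by auto
    qed (use True f1(2)[of t] g1(2)[of t] in auto)
    then show ?thesis using True by simp
  next
    case False
    have "\<not> ennreal t < f x" "\<not> ennreal t < g x" if "t \<ge> 1" for x
      using f1(1)[of x] g1(1)[of x] that
      by (metis ennreal_1 ennreal_leI leD order.trans)+
    then show ?thesis using False by (cases "t \<le> 0") auto
  qed
  have cake: "?I f = (\<integral>\<^sup>+t. indicator {0<..} t * ?L f t \<partial>lborel)"
    if "f \<in> borel_measurable borel" for f :: "real \<Rightarrow> ennreal"
    using nn_integral_layer_cake[OF sigma_finite_lborel, of f] that by simp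
  have [measurable]: "(\<lambda>t. ?L f t) \<in> borel_measurable borel"
    if [measurable]: "f \<in> borel_measurable borel" for f :: "real \<Rightarrow> ennreal"
  proof -
    have "(\<lambda>t. emeasure lborel {x \<in> space lborel. ennreal t < f x}) \<in> borel_measurable lborel"
      by measurable
    then show ?thesis by simp
  qed
  have "?I f + ?I g = (\<integral>\<^sup>+t. indicator {0<..} t * ?L f t + indicator {0<..} t * ?L g t \<partial>lborel)"
    unfolding cake[OF assms(1)] cake[OF assms(2)] by (rule nn_integral_add[symmetric]) measurable
  also have "\<dots> \<le> (\<integral>\<^sup>+t. 2 * (indicator {0<..} t * ?L h t) \<partial>lborel)"
    by (intro nn_integral_mono level)
  also have "\<dots> = 2 * ?I h"
    unfolding cake[OF assms(3)] by (rule nn_integral_cmult) measurable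
  finally have sum: "?I f + ?I g \<le> 2 * ?I h" .
  have "4 * (?I f * ?I g) \<le> (?I f + ?I g)\<^sup>2" by (rule ennreal_four_mult_le_add_square)
  also have "\<dots> \<le> (2 * ?I h)\<^sup>2" using sum by (rule power_mono) simp
  also have "\<dots> = 4 * (?I h)\<^sup>2" by (simp add: power_mult_distrib)
  finally show ?thesis by (subst (asm) ennreal_mult_le_mult_iff) auto
qed

lemma prekopa_leindler_real_bounded:
  fixes f g h :: "real \<Rightarrow> ennreal"
  assumes [measurable]: "f \<in> borel_measurable borel" "g \<in> borel_measurable borel" "h \<in> borel_measurable borel"
    and le: "\<And>x y. f x * g y \<le> (h ((x + y) / 2))\<^sup>2"
    and bd: "\<And>x. f x \<le> ennreal r" "\<And>x. g x \<le> ennreal r"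
  shows "(\<integral>\<^sup>+x. f x \<partial>lborel) * (\<integral>\<^sup>+x. g x \<partial>lborel) \<le> (\<integral>\<^sup>+x. h x \<partial>lborel)\<^sup>2"
proof (cases "(\<exists>x. f x \<noteq> 0) \<and> (\<exists>x. g x \<noteq> 0)")
  case False
  then show ?thesis by auto
next
  case True
  let ?I = "\<lambda>f. \<integral>\<^sup>+x. f x \<partial>lborel"
  obtain m where m: "m > 0" "\<And>x. f x \<le> ennreal m" "\<And>s. s < m \<Longrightarrow> 0 \<le> s \<Longrightarrow> \<exists>x. ennreal s < f x"
    using ennreal_Sup_bounded[of f r] bd True by blast
  obtain k where k: "k > 0" "\<And>x. g x \<le> ennreal k" "\<And>s. s < k \<Longrightarrow> 0 \<le> s \<Longrightarrow> \<exists>x. ennreal s < g x"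
    using ennreal_Sup_bounded[of g r] bd True by blast
  \<comment> \<open>Dividing \<open>f\<close> by \<open>m\<close>, \<open>g\<close> by
    \<open>k\<close> and \<open>h\<close> by their geometric mean scales both sides, of the
    hypothesis and of the conclusion, by 1 / (m k).\<close>
  define q where "q = sqrt (m * k)"
  have q: "q > 0" "q * q = m * k" using m k by (auto simp: q_def)
  have cancel: "ennreal (1 / m') * ennreal m' = 1" if "m' > 0" for m'
    using that by (simp flip: ennreal_mult)
  have le1: "ennreal (1 / m') * y \<le> 1" if "m' > 0" "y \<le> ennreal m'" for m' y
    using mult_left_mono[OF that(2), of "ennreal (1 / m')"] cancel[OF that(1)] by simp
  have sup1: "\<exists>x. ennreal s < ennreal (1 / m') * u x"
    if "m' > 0" and s: "0 \<le> s" "s < 1" and u: "\<And>s. s < m' \<Longrightarrow> 0 \<le> s \<Longrightarrow> \<exists>x. ennreal s < u x"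
    for m' s and u :: "real \<Rightarrow> ennreal"
  proof -
    obtain x where x: "ennreal (s * m') < u x" using u[of "s * m'"] \<open>0 < m'\<close> s by auto
    have "ennreal (1 / m') * ennreal (s * m') < ennreal (1 / m') * u x"
      using x \<open>0 < m'\<close> by (intro ennreal_mult_strict_left_mono) auto
    moreover have "ennreal (1 / m') * ennreal (s * m') = ennreal s"
      using \<open>0 < m'\<close> \<open>0 \<le> s\<close> by (simp flip: ennreal_mult)
    ultimately show ?thesis by auto
  qed
  have cmult: "?I (\<lambda>x. a * u x) = a * ?I u" if "u \<in> borel_measurable borel" for a and u :: "real \<Rightarrow> ennreal"
    using that by (intro nn_integral_cmult) simp
  have qq: "ennreal (1 / m) * ennreal (1 / k) = (ennreal (1 / q))\<^sup>2"
    using q m k by (simp add: power2_eq_square flip: ennreal_mult)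
  have "?I (\<lambda>x. ennreal (1 / m) * f x) * ?I (\<lambda>x. ennreal (1 / k) * g x) \<le> (?I (\<lambda>x. ennreal (1 / q) * h x))\<^sup>2"
  proof (rule prekopa_leindler_real_normalized)
    fix x y
    have "ennreal (1 / m) * f x * (ennreal (1 / k) * g y) = (ennreal (1 / m) * ennreal (1 / k)) * (f x * g y)"
      by (simp add: mult_ac)
    also have "\<dots> \<le> (ennreal (1 / m) * ennreal (1 / k)) * (h ((x + y) / 2))\<^sup>2"
      by (rule mult_left_mono[OF le]) simp
    finally show "ennreal (1 / m) * f x * (ennreal (1 / k) * g y) \<le> (ennreal (1 / q) * h ((x + y) / 2))\<^sup>2"
      by (simp add: qq power_mult_distrib)
  qed (use m k le1 sup1[of m _ f] sup1[of k _ g] in auto)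
  also have "?I (\<lambda>x. ennreal (1 / m) * f x) * ?I (\<lambda>x. ennreal (1 / k) * g x)
      = (ennreal (1 / m) * ennreal (1 / k)) * (?I f * ?I g)"
    unfolding cmult[OF assms(1)] cmult[OF assms(2)] by (simp only: mult_ac)
  also have "(?I (\<lambda>x. ennreal (1 / q) * h x))\<^sup>2 = (ennreal (1 / m) * ennreal (1 / k)) * (?I h)\<^sup>2"
    unfolding cmult[OF assms(3)] qq by (rule power_mult_distrib)
  finally have "(ennreal (1 / m) * ennreal (1 / k)) * (?I f * ?I g)
      \<le> (ennreal (1 / m) * ennreal (1 / k)) * (?I h)\<^sup>2" .
  moreover have "ennreal (1 / m) * ennreal (1 / k) \<noteq> 0" "ennreal (1 / m) * ennreal (1 / k) \<noteq> top"
    using m(1) k(1) by (auto simp: ennreal_mult_eq_top_iff)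
  ultimately show ?thesis using ennreal_mult_le_mult_iff by blast
qed

lemma nn_integral_min_of_nat_SUP:
  assumes [measurable]: "f \<in> borel_measurable M"
  shows "(SUP n. \<integral>\<^sup>+x. min (f x) (of_nat n) \<partial>M) = (\<integral>\<^sup>+x. f x \<partial>M)"
proof -
  have "(SUP n. min (f x) (of_nat n)) = f x" for x
  proof (rule antisym)
    show "f x \<le> (SUP n. min (f x) (of_nat n))"
    proof (rule dense_le)
      fix y assume "y < f x"
      then have "y < top" by (simp add: less_top order_less_le_trans)
      then obtain n where "y < of_nat n" using ennreal_Ex_less_of_nat by blast
      with \<open>y < f x\<close> have "y \<le> min (f x) (of_nat n)" by (simp add: less_imp_le)
      then show "y \<le> (SUP n. min (f x) (of_nat n))" by (rule SUP_upper2[OF UNIV_I])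
    qed
  qed (rule SUP_least, simp)
  then show ?thesis
    by (subst nn_integral_monotone_convergence_SUP[symmetric])
       (auto simp: incseq_def le_fun_def intro: order_trans[OF min.cobounded2 of_nat_mono])
qed

text \<open>Truncating \<open>f\<close> and \<open>g\<close> at height n only lowers the left side
  of the hypothesis, so the same \<open>h\<close> serves for every n, and monotone convergence
  finishes.\<close>

lemma prekopa_leindler_real:
  fixes f g h :: "real \<Rightarrow> ennreal"
  assumes [measurable]: "f \<in> borel_measurable borel" "g \<in> borel_measurable borel" "h \<in> borel_measurable borel"
    and le: "\<And>x y. f x * g y \<le> (h ((x + y) / 2))\<^sup>2"
  shows "(\<integral>\<^sup>+x. f x \<partial>lborel) * (\<integral>\<^sup>+x. g x \<partial>lborel) \<le> (\<integral>\<^sup>+x. h x \<partial>lborel)\<^sup>2"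
proof -
  let ?I = "\<lambda>f. \<integral>\<^sup>+x. f x \<partial>lborel"
  let ?f = "\<lambda>n x. min (f x) (of_nat n)" and ?g = "\<lambda>n x. min (g x) (of_nat n)"
  have step: "?I (?f n) * ?I (?g n) \<le> (?I h)\<^sup>2" for n
  proof (rule prekopa_leindler_real_bounded)
    fix x y
    have "?f n x * ?g n y \<le> f x * g y" by (intro mult_mono) auto
    also note le
    finally show "?f n x * ?g n y \<le> (h ((x + y) / 2))\<^sup>2" .
    show "?f n x \<le> ennreal (real n)" "?g n x \<le> ennreal (real n)"
      by (simp_all add: ennreal_of_nat_eq_real_of_nat)
  qed auto
  have mono: "incseq (\<lambda>n. ?I (\<lambda>x. min (u x) (of_nat n)))" for u :: "real \<Rightarrow> ennreal"
    by (auto simp: incseq_def intro!: nn_integral_mono intro: order_trans[OF min.cobounded2 of_nat_mono])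
  have "?I f * ?I g = (SUP n. ?I (?f n)) * (SUP n. ?I (?g n))"
    by (simp add: nn_integral_min_of_nat_SUP)
  also have "\<dots> = (SUP k. SUP n. ?I (?f n) * ?I (?g k))"
    by (simp add: SUP_mult_left_ennreal SUP_mult_right_ennreal)
  also have "\<dots> \<le> (?I h)\<^sup>2"
  proof (intro SUP_least)
    fix n k
    \<comment> \<open>The two suprema run independently; passing to the larger index brings both to
      the same truncation.\<close>
    have "?I (?f n) * ?I (?g k) \<le> ?I (?f (max n k)) * ?I (?g (max n k))"
      by (intro mult_mono incseqD[OF mono]) auto
    also note step
    finally show "?I (?f n) * ?I (?g k) \<le> (?I h)\<^sup>2" .
  qed
  finally show ?thesis .
qed

section \<open>Induction on the dimension\<close>

text \<open>For fixed values s and t of the new coordinate, the induction hypothesis for the slices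
  is the pointwise hypothesis of the one-dimensional inequality for the partial integrals.
  Describing the midpoint by its coordinates lets it be assembled as an update of
  \<open>z\<close>.\<close>

lemma prekopa_leindler_PiM:
  fixes f g h :: "('i \<Rightarrow> real) \<Rightarrow> ennreal"
  assumes "finite I"
    and "f \<in> borel_measurable (\<Pi>\<^sub>M i\<in>I. lborel)" "g \<in> borel_measurable (\<Pi>\<^sub>M i\<in>I. lborel)"
      "h \<in> borel_measurable (\<Pi>\<^sub>M i\<in>I. lborel)"
    and "\<And>x y z. x \<in> extensional I \<Longrightarrow> y \<in> extensional I \<Longrightarrow> z \<in> extensional I \<Longrightarrow>
      (\<And>i. i \<in> I \<Longrightarrow> z i = (x i + y i) / 2) \<Longrightarrow> f x * g y \<le> (h z)\<^sup>2"
  shows "(\<integral>\<^sup>+x. f x \<partial>(\<Pi>\<^sub>M i\<in>I. lborel)) * (\<integral>\<^sup>+x. g x \<partial>(\<Pi>\<^sub>M i\<in>I. lborel))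
    \<le> (\<integral>\<^sup>+x. h x \<partial>(\<Pi>\<^sub>M i\<in>I. lborel))\<^sup>2"
  using assms
proof (induction I arbitrary: f g h rule: finite_induct)
  case empty
  then show ?case by (simp add: product_sigma_finite.nn_integral_empty[unfolded product_sigma_finite_def]
        nn_integral_count_space_finite PiM_empty)
next
  case (insert i I)
  interpret product_sigma_finite "\<lambda>_::'i. lborel :: real measure"
    by (simp add: product_sigma_finite_def sigma_finite_lborel)
  interpret I: finite_product_sigma_finite "\<lambda>_::'i. lborel :: real measure" I
    by standard (rule insert.hyps)
  note [measurable] = insert.prems(1-3)
  have meas: "(\<lambda>t. \<integral>\<^sup>+x. u (x(i := t)) \<partial>(\<Pi>\<^sub>M i\<in>I. lborel)) \<in> borel_measurable borel"
    if [measurable]: "u \<in> borel_measurable (\<Pi>\<^sub>M i\<in>insert i I. lborel)" for u :: "('i \<Rightarrow> real) \<Rightarrow> ennreal"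
  proof -
    have "(\<lambda>t. \<integral>\<^sup>+x. u (x(i := t)) \<partial>(\<Pi>\<^sub>M i\<in>I. lborel)) \<in> borel_measurable lborel"
      by measurable
    then show ?thesis by simp
  qed
  have slice: "(\<lambda>x. u (x(i := t))) \<in> borel_measurable (\<Pi>\<^sub>M i\<in>I. lborel)"
    if [measurable]: "u \<in> borel_measurable (\<Pi>\<^sub>M i\<in>insert i I. lborel)" for u :: "('i \<Rightarrow> real) \<Rightarrow> ennreal" and t
    by measurable
  show ?case
    unfolding product_nn_integral_insert_rev[OF insert.hyps insert.prems(1)]
      product_nn_integral_insert_rev[OF insert.hyps insert.prems(2)]
      product_nn_integral_insert_rev[OF insert.hyps insert.prems(3)]
  proof (rule prekopa_leindler_real)
    fix s t :: real
    show "(\<integral>\<^sup>+x. f (x(i := s)) \<partial>(\<Pi>\<^sub>M i\<in>I. lborel)) * (\<integral>\<^sup>+x. g (x(i := t)) \<partial>(\<Pi>\<^sub>M i\<in>I. lborel))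
      \<le> (\<integral>\<^sup>+x. h (x(i := (s + t) / 2)) \<partial>(\<Pi>\<^sub>M i\<in>I. lborel))\<^sup>2"
      using insert.hyps
      by (intro insert.IH slice insert.prems) (auto simp: extensional_def)
  qed (intro meas insert.prems)+
qed

lemma prekopa_leindler:
  fixes f g h :: "'a::euclidean_space \<Rightarrow> ennreal"
  assumes [measurable]: "f \<in> borel_measurable borel" "g \<in> borel_measurable borel" "h \<in> borel_measurable borel"
    and le: "\<And>x y. f x * g y \<le> (h ((x + y) /\<^sub>R 2))\<^sup>2"
  shows "(\<integral>\<^sup>+x. f x \<partial>lborel) * (\<integral>\<^sup>+x. g x \<partial>lborel) \<le> (\<integral>\<^sup>+x. h x \<partial>lborel)\<^sup>2"
proof -
  let ?T = "\<lambda>f::'a \<Rightarrow> real. \<Sum>b\<in>Basis. f b *\<^sub>R b"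
  have T: "?T \<in> (\<Pi>\<^sub>M b\<in>Basis. lborel) \<rightarrow>\<^sub>M borel"
    by measurable
  have I: "(\<integral>\<^sup>+x. u x \<partial>lborel) = (\<integral>\<^sup>+x. u (?T x) \<partial>(\<Pi>\<^sub>M b\<in>Basis. lborel))"
    if "u \<in> borel_measurable borel" for u :: "'a \<Rightarrow> ennreal"
    using that by (subst lborel_eq) (rule nn_integral_distr[OF T], simp)
  show ?thesis
    unfolding I[OF assms(1)] I[OF assms(2)] I[OF assms(3)]
  proof (rule prekopa_leindler_PiM)
    fix x y z :: "'a \<Rightarrow> real" assume z: "\<And>i. i \<in> Basis \<Longrightarrow> z i = (x i + y i) / 2"
    have "?T z = (?T x + ?T y) /\<^sub>R 2"
      by (simp add: z sum.distrib scaleR_sum_right scaleR_add_left scaleR_add_right add_divide_distrib)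
    then show "f (?T x) * g (?T y) \<le> (h (?T z))\<^sup>2" using le by simp
  qed (use T in measurable)
qed

section \<open>Log-concavity of halfspace probabilities\<close>

text \<open>Passage to real-valued convexity on the effective domain, from which continuity of the
  density in the interior follows.\<close>

lemma ereal_concaveD_convex_on:
  assumes "ereal_concave \<phi>"
  shows "convex {x. \<phi> x \<noteq> - \<infinity>}" "convex_on {x. \<phi> x \<noteq> - \<infinity>} (\<lambda>x. - real_of_ereal (\<phi> x))"
proof -
  let ?D = "{x. \<phi> x \<noteq> - \<infinity>}" and ?r = "\<lambda>x. real_of_ereal (\<phi> x)"
  have fin: "\<phi> x = ereal (?r x)" if "x \<in> ?D" for x
    using that assms by (auto simp: ereal_concave_def ereal_real)
  have key: "(1 - t) *\<^sub>R x + t *\<^sub>R y \<in> ?D \<and> (1 - t) * ?r x + t * ?r y \<le> ?r ((1 - t) *\<^sub>R x + t *\<^sub>R y)"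
    if "x \<in> ?D" "y \<in> ?D" "0 < t" "t < 1" for x y t
  proof -
    have "ereal (1 - t) * \<phi> x + ereal t * \<phi> y \<le> \<phi> ((1 - t) *\<^sub>R x + t *\<^sub>R y)"
      using assms that(3,4) by (auto simp: ereal_concave_def)
    then have le: "ereal ((1 - t) * ?r x + t * ?r y) \<le> \<phi> ((1 - t) *\<^sub>R x + t *\<^sub>R y)"
      by (subst (asm) fin[OF that(1)], subst (asm) fin[OF that(2)]) simp
    then have D: "(1 - t) *\<^sub>R x + t *\<^sub>R y \<in> ?D" by auto
    show ?thesis using le D by (subst (asm) fin[OF D]) simp
  qed
  have D: "convex ?D"
    unfolding convex_alt using key
    by (metis (no_types, lifting) add.right_neutral add_0 diff_zero diff_self order_le_less scaleR_one scaleR_zero_left)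
  then show "convex ?D" .
  show "convex_on ?D (\<lambda>x. - ?r x)"
  proof (rule convex_onI)
    fix t :: real and x y assume "0 < t" "t < 1" "x \<in> ?D" "y \<in> ?D"
    then show "- ?r ((1 - t) *\<^sub>R x + t *\<^sub>R y) \<le> (1 - t) * - ?r x + t * - ?r y"
      using key[of x y t] by simp
  qed (rule D)
qed

text \<open>A concave function may fail to be Borel on the boundary of its effective domain; this boundary is
  negligible, so the density may be set to zero there.\<close>

lemma log_concave_distributions_borel_density:
  fixes Q :: "'a::euclidean_space measure"
  assumes "Q \<in> log_concave_distributions"
  obtains f :: "'a \<Rightarrow> ennreal" where "f \<in> borel_measurable borel"
    "\<And>x y. f x * f y \<le> (f ((x + y) /\<^sub>R 2))\<^sup>2"
    "\<And>B. B \<in> sets borel \<Longrightarrow> emeasure Q B = (\<integral>\<^sup>+x\<in>B. f x \<partial>lborel)"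
proof -
  obtain \<phi> where \<phi>: "ereal_concave \<phi>"
    and Q: "\<And>B. B \<in> sets borel \<Longrightarrow> emeasure Q B = (\<integral>\<^sup>+ x\<in>B. ennreal (exp_ereal (\<phi> x)) \<partial>lebesgue)"
    using assms by (auto simp: log_concave_distributions_def)
  define D where "D = {x. \<phi> x \<noteq> - \<infinity>}"
  define r where "r x = real_of_ereal (\<phi> x)" for x
  have convD: "convex D" and conv: "convex_on D (\<lambda>x. - r x)"
    using ereal_concaveD_convex_on[OF \<phi>] by (auto simp: D_def r_def)
  have conv_int: "convex_on (interior D) (\<lambda>x. - r x)"
    using conv interior_subset convex_interior[OF convD] by (rule convex_on_subset)
  have "continuous_on (interior D) (\<lambda>x. - r x)"
    by (rule convex_on_continuous[OF open_interior conv_int])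
  then have cont: "continuous_on (interior D) (\<lambda>x. exp (r x))"
    using continuous_on_minus[of "interior D" "\<lambda>x. - r x"] by (auto intro: continuous_on_exp)
  define f where "f x = ennreal (indicator (interior D) x *\<^sub>R exp (r x))" for x
  have "f \<in> borel_measurable borel"
    unfolding f_def[abs_def] using borel_measurable_continuous_on_indicator[OF _ cont] by simp
  \<comment> \<open>The left side vanishes unless both points lie in \<open>interior D\<close>,
    which is convex and hence contains their midpoint.\<close>
  moreover have "f x * f y \<le> (f ((x + y) /\<^sub>R 2))\<^sup>2" for x y
  proof (cases "x \<in> interior D \<and> y \<in> interior D")
    case True
    have eq: "(x + y) /\<^sub>R 2 = (1 - 1/2) *\<^sub>R x + (1/2) *\<^sub>R y" by (simp add: scaleR_add_right)
    have "(x + y) /\<^sub>R 2 \<in> interior D"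
      unfolding eq using True convex_interior[OF convD] by (intro convexD_alt) auto
    moreover have "r x + r y \<le> 2 * r ((x + y) /\<^sub>R 2)"
      unfolding eq using convex_onD[OF conv_int, of "1/2" x y] True by simp
    ultimately show ?thesis
      using True by (simp add: f_def power2_eq_square flip: ennreal_mult exp_add)
  qed (auto simp: f_def)
  moreover have "emeasure Q B = (\<integral>\<^sup>+x\<in>B. f x \<partial>lborel)" if "B \<in> sets borel" for B
  proof -
    have "negligible (frontier D)" by (rule negligible_convex_frontier[OF convD])
    then have "AE x in lebesgue. x \<notin> frontier D"
      by (auto simp: negligible_iff_null_sets intro: AE_not_in)
    then have "AE x in lebesgue. ennreal (exp_ereal (\<phi> x)) * indicator B x = f x * indicator B x"
    proof eventually_elim
      case (elim x)
      then have "x \<in> interior D \<or> x \<notin> D"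
        using closure_subset by (auto simp: frontier_def)
      moreover have "x \<in> interior D \<Longrightarrow> x \<in> D" using interior_subset by blast
      ultimately show ?case
        by (cases "x \<in> interior D") (auto simp: f_def exp_ereal_def D_def r_def)
    qed
    then have "emeasure Q B = (\<integral>\<^sup>+x\<in>B. f x \<partial>lebesgue)"
      unfolding Q[OF that] by (rule nn_integral_cong_AE)
    then show ?thesis by (simp add: nn_integral_completion)
  qed
  ultimately show thesis using that by blast
qed

text \<open>Cutting the density down to the three halfspaces preserves the hypothesis of
  Prekopa-Leindler, because a midpoint of points from the first two lies in the third.\<close>

lemma log_concave_distributions_halfspace:
  fixes Q :: "'a::euclidean_space measure" and u :: 'a
  assumes Q: "Q \<in> log_concave_distributions"
  shows "measure Q {x. s \<le> u \<bullet> x} * measure Q {x. t \<le> u \<bullet> x} \<le> (measure Q {x. (s + t) / 2 \<le> u \<bullet> x})\<^sup>2"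
proof -
  interpret prob_space Q using Q by (simp add: log_concave_distributions_def)
  obtain f :: "'a \<Rightarrow> ennreal" where f: "f \<in> borel_measurable borel"
    "\<And>x y. f x * f y \<le> (f ((x + y) /\<^sub>R 2))\<^sup>2"
    "\<And>B. B \<in> sets borel \<Longrightarrow> emeasure Q B = (\<integral>\<^sup>+x\<in>B. f x \<partial>lborel)"
    using log_concave_distributions_borel_density[OF Q] by blast
  note [measurable] = f(1)
  have "emeasure Q {x. s \<le> u \<bullet> x} * emeasure Q {x. t \<le> u \<bullet> x} \<le> (emeasure Q {x. (s + t) / 2 \<le> u \<bullet> x})\<^sup>2"
    unfolding f(3)[OF borel_closed[OF closed_halfspace_ge]]
  proof (rule prekopa_leindler)
    fix x y
    show "f x * indicator {x. s \<le> u \<bullet> x} x * (f y * indicator {x. t \<le> u \<bullet> x} y)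
      \<le> (f ((x + y) /\<^sub>R 2) * indicator {x. (s + t) / 2 \<le> u \<bullet> x} ((x + y) /\<^sub>R 2))\<^sup>2"
      using f(2)[of x y] by (auto simp: indicator_def inner_add_right)
  qed measurable
  then show ?thesis
    by (simp add: emeasure_eq_measure power2_eq_square flip: ennreal_mult)
qed

section \<open>Polynomials as combinations of powers of linear forms\<close>

text \<open>Products are left out of the rules on purpose: integrability and limits of integrals
  pass to sums and multiples, so an induction over this set can carry them. Closure under products
  is a separate theorem.\<close>

inductive_set ridge_span :: "('a::euclidean_space \<Rightarrow> real) set" where
  power: "(\<lambda>x. (u \<bullet> x) ^ k) \<in> ridge_span"
| add: "f \<in> ridge_span \<Longrightarrow> g \<in> ridge_span \<Longrightarrow> (\<lambda>x. f x + g x) \<in> ridge_span"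
| scale: "f \<in> ridge_span \<Longrightarrow> (\<lambda>x. c * f x) \<in> ridge_span"

lemma ridge_span_const: "(\<lambda>x. c) \<in> ridge_span"
  using ridge_span.scale[OF ridge_span.power[of 0 0], of c] by simp

lemma ridge_span_sum:
  "finite A \<Longrightarrow> (\<And>i. i \<in> A \<Longrightarrow> f i \<in> ridge_span) \<Longrightarrow> (\<lambda>x. \<Sum>i\<in>A. f i x) \<in> ridge_span"
  by (induction A rule: finite_induct) (auto intro: ridge_span_const ridge_span.add)

text \<open>Writing p s for the given polynomial in s, the combination p (2 s) - 2 ^ n * p s kills the leading
  coefficient and multiplies every other one by a nonzero constant.\<close>

lemma ridge_span_coefficients:
  assumes "\<And>s. (\<lambda>x. \<Sum>i\<le>n. s ^ i * g i x) \<in> ridge_span" "i \<le> n"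
  shows "g i \<in> ridge_span"
  using assms
proof (induction n arbitrary: g i)
  case 0
  then show ?case using "0.prems"(1)[of 1] by simp
next
  case (Suc n)
  define h where "h i x = (2 ^ i - 2 ^ Suc n) * g i x" for i x
  have lower: "g i \<in> ridge_span" if "i \<le> n" for i
  proof -
    have "h i \<in> ridge_span"
    proof (rule Suc.IH[OF _ that])
      fix s :: real
      have "(\<lambda>x. (\<Sum>i\<le>Suc n. (2 * s) ^ i * g i x) + (- (2 ^ Suc n)) * (\<Sum>i\<le>Suc n. s ^ i * g i x)) \<in> ridge_span"
        by (intro ridge_span.add ridge_span.scale Suc.prems(1))
      moreover have "(\<Sum>i\<le>Suc n. (2 * s) ^ i * g i x) + (- (2 ^ Suc n)) * (\<Sum>i\<le>Suc n. s ^ i * g i x)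
          = (\<Sum>i\<le>n. s ^ i * h i x)" for x
        unfolding sum_distrib_left sum.distrib[symmetric]
        by (simp add: h_def power_mult_distrib algebra_simps)
      ultimately show "(\<lambda>x. \<Sum>i\<le>n. s ^ i * h i x) \<in> ridge_span" by simp
    qed
    then have "(\<lambda>x. inverse (2 ^ i - 2 ^ Suc n) * h i x) \<in> ridge_span" by (rule ridge_span.scale)
    moreover have "(2::real) ^ i < 2 ^ Suc n" using that by (intro power_strict_increasing) auto
    then have "(\<lambda>x. inverse (2 ^ i - 2 ^ Suc n) * h i x) = g i"
      by (simp add: h_def fun_eq_iff del: power_Suc flip: mult.assoc)
    ultimately show ?thesis by simp
  qed
  \<comment> \<open>At s = 1 the polynomial is the sum of its coefficients; removing the lower ones
    isolates the leading one.\<close>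
  have "(\<lambda>x. (\<Sum>i\<le>Suc n. 1 ^ i * g i x) + (- 1) * (\<Sum>i\<le>n. g i x)) \<in> ridge_span"
    by (intro ridge_span.add ridge_span.scale Suc.prems(1) ridge_span_sum lower) auto
  then have "g (Suc n) \<in> ridge_span" by simp
  then show ?case using lower Suc.prems(2) by (cases "i = Suc n") auto
qed

text \<open>Polarization: the power j + k of the linear form given by u + s v lies in the span for
  every s, and by the binomial theorem its coefficient at s^k is the product up to a nonzero
  factor.\<close>

lemma ridge_span_power_mult: "(\<lambda>x. (u \<bullet> x) ^ j * (v \<bullet> x) ^ k) \<in> ridge_span"
proof -
  define n where "n = j + k"
  define g where "g i x = of_nat (n choose i) * (v \<bullet> x) ^ i * (u \<bullet> x) ^ (n - i)" for i x
  have "g k \<in> ridge_span"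
  proof (rule ridge_span_coefficients)
    fix s
    have "(\<Sum>i\<le>n. s ^ i * g i x) = ((u + s *\<^sub>R v) \<bullet> x) ^ n" for x
      unfolding g_def by (simp add: inner_add_left add.commute[of "u \<bullet> x"] binomial_ring power_mult_distrib mult_ac)
    then show "(\<lambda>x. \<Sum>i\<le>n. s ^ i * g i x) \<in> ridge_span"
      using ridge_span.power[of "u + s *\<^sub>R v" n] by simp
  qed (simp add: n_def)
  then have "(\<lambda>x. inverse (of_nat (n choose k)) * g k x) \<in> ridge_span" by (rule ridge_span.scale)
  then show ?thesis by (simp add: g_def n_def mult_ac)
qed

lemma ridge_span_mult:
  assumes "f \<in> ridge_span" "g \<in> ridge_span"
  shows "(\<lambda>x. f x * g x) \<in> ridge_span"
  using assms(1)
proof induction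
  case (power u j)
  from assms(2) show ?case
  proof induction
    case (power v k)
    show ?case by (rule ridge_span_power_mult)
  next
    case (add f g)
    then show ?case using ridge_span.add[OF add.IH] by (simp add: distrib_left)
  next
    case (scale f c)
    then show ?case using ridge_span.scale[OF scale.IH, of c] by (simp add: mult_ac)
  qed
next
  case (add f h)
  then show ?case using ridge_span.add[OF add.IH] by (simp add: distrib_right)
next
  case (scale f c)
  then show ?case using ridge_span.scale[OF scale.IH, of c] by (simp add: mult_ac)
qed

lemma real_polynomial_function_in_ridge_span:
  fixes p :: "'a::euclidean_space \<Rightarrow> real"
  assumes "real_polynomial_function p"
  shows "p \<in> ridge_span"
  using assms
proof induction
  case (linear f)
  \<comment> \<open>The vector \<open>adjoint f 1\<close> represents the functional \<open>f\<close>
    through the inner product.\<close>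
  have "f x = (adjoint f 1 \<bullet> x) ^ 1" for x
    using adjoint_works[OF bounded_linear.linear[OF linear], of x 1] by (simp add: inner_commute)
  then have "f = (\<lambda>x. (adjoint f 1 \<bullet> x) ^ 1)" by blast
  then show ?case using ridge_span.power[of "adjoint f 1" 1] by simp
qed (auto intro: ridge_span_const ridge_span.add ridge_span_mult)

section \<open>Uniform moment bounds\<close>

lemma log_concave_distributions_prob_space:
  assumes "Q \<in> log_concave_distributions"
  shows "prob_space Q" "sets Q = sets borel" "space Q = UNIV"
  using assms sets_eq_imp_space_eq[of Q borel] by (auto simp: log_concave_distributions_def)

text \<open>Each threshold is the midpoint of its neighbours at distance 2 t, so the quotients of
  successive tail probabilities do not increase. The first quotient compares the thresholds t and -
  t and is at most (1/4) / (3/4) = 1/3.\<close>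

lemma log_concave_geometric_tail:
  fixes u :: "'a::euclidean_space"
  assumes Q: "Q \<in> log_concave_distributions" and t: "t > 0"
    and lo: "measure Q {x. - t \<le> u \<bullet> x} \<ge> 3/4" and hi: "measure Q {x. t \<le> u \<bullet> x} \<le> 1/4"
  shows "measure Q {x. (2 * real j - 1) * t \<le> u \<bullet> x} \<le> (1/3) ^ j"
proof -
  interpret prob_space Q by (rule log_concave_distributions_prob_space[OF Q])
  have [measurable_cong]: "sets Q = sets borel" by (rule log_concave_distributions_prob_space[OF Q])
  define r where "r j = measure Q {x. (2 * real j - 1) * t \<le> u \<bullet> x}" for j :: nat
  have mono: "r (Suc j) \<le> r j" for j
    unfolding r_def
    using t by (intro finite_measure_mono) (auto simp: algebra_simps, measurable)
  have lc: "r j * r (Suc (Suc j)) \<le> (r (Suc j))\<^sup>2" for j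
  proof -
    have "((2 * real j - 1) * t + (2 * real (Suc (Suc j)) - 1) * t) / 2 = (2 * real (Suc j) - 1) * t"
      by (simp add: algebra_simps)
    then show ?thesis
      using log_concave_distributions_halfspace[OF Q, of "(2 * real j - 1) * t" u "(2 * real (Suc (Suc j)) - 1) * t"]
      by (simp only: r_def)
  qed
  have ratio: "3 * r (Suc j) \<le> r j" for j
  proof (induction j)
    case 0
    then show ?case using lo hi by (simp add: r_def)
  next
    case (Suc j)
    show ?case
    proof (cases "r j = 0")
      \<comment> \<open>Division by \<open>r j\<close> is impossible here, but the induction
        hypothesis forces \<open>r (Suc j) = 0\<close>, and monotonicity does the rest.\<close>
      case True
      have "r (Suc (Suc j)) \<ge> 0" "r (Suc j) \<ge> 0" by (simp_all add: r_def)
      then show ?thesis using Suc True mono[of "Suc j"] by linarith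
    next
      case False
      then have pos: "r j > 0" by (simp add: r_def order_less_le)
      have "r j * (3 * r (Suc (Suc j))) \<le> 3 * (r (Suc j) * r (Suc j))"
        using lc[of j] by (simp add: power2_eq_square)
      also have "\<dots> = (3 * r (Suc j)) * r (Suc j)" by simp
      also have "\<dots> \<le> r j * r (Suc j)" using Suc by (intro mult_right_mono) (auto simp: r_def)
      finally show ?thesis using pos by simp
    qed
  qed
  have "r j \<le> (1/3) ^ j"
  proof (induction j)
    case 0
    then show ?case by (simp add: r_def)
  next
    case (Suc j)
    then show ?case using ratio[of j] by simp
  qed
  then show ?thesis by (simp add: r_def)
qed

lemma summable_power_mult_geometric:
  fixes t :: real
  shows "summable (\<lambda>j. ((2 * real j + 1) * t) ^ m * (1/3) ^ j)"
proof -
  have le: "(2 * real j + 1) ^ m \<le> (fact m * 4 ^ m * 2) * 2 ^ j" for j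
  proof -
    \<comment> \<open>The bound y^m / m! \<le> exp y is applied with divisor 4 so that the growth in
      j is that of exp (1/2)^j, at most 2^j, which the factor (1/3)^j beats.\<close>
    define y where "y = (2 * real j + 1) / 4"
    have y: "y \<ge> 0" by (simp add: y_def)
    have "y ^ m / fact m \<le> exp y"
      using sum_le_suminf[OF summable_exp_generic[of y], of "{m}"] y
      by (simp add: exp_def divide_inverse mult_ac)
    also have "exp y = exp (1/4) * exp (1/2) ^ j"
      by (simp add: y_def add_divide_distrib exp_add exp_of_nat_mult[symmetric] mult_ac)
    also have "\<dots> \<le> 2 * 2 ^ j"
    proof (intro mult_mono power_mono)
      have "exp (1/4) \<le> exp (1/2::real)" by simp
      also note exp_half_le2
      finally show "exp (1/4) \<le> (2::real)" .
    qed (use exp_half_le2 in auto)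
    finally have "y ^ m \<le> fact m * (2 * 2 ^ j)" by (simp add: field_simps)
    then have scaled: "4 ^ m * y ^ m \<le> 4 ^ m * (fact m * (2 * 2 ^ j))" by (rule mult_left_mono) simp
    have y4: "4 * y = 2 * real j + 1" by (simp add: y_def)
    have "(2 * real j + 1) ^ m \<le> 4 ^ m * (fact m * (2 * 2 ^ j))"
      using scaled unfolding power_mult_distrib[symmetric] y4 .
    then show ?thesis by (simp add: mult_ac)
  qed
  show ?thesis
  proof (rule summable_comparison_test')
    show "summable (\<lambda>j. (fact m * 4 ^ m * 2 * \<bar>t\<bar> ^ m) * (2/3) ^ j)"
      by (intro summable_mult summable_geometric) simp
    fix j :: nat
    have "norm (((2 * real j + 1) * t) ^ m * (1/3) ^ j) = (2 * real j + 1) ^ m * (\<bar>t\<bar> ^ m * (1/3) ^ j)"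
      by (simp add: norm_mult norm_power abs_mult power_abs power_mult_distrib)
    also have "\<dots> \<le> ((fact m * 4 ^ m * 2) * 2 ^ j) * (\<bar>t\<bar> ^ m * (1/3) ^ j)"
      by (rule mult_right_mono[OF le]) simp
    also have "\<dots> = (fact m * 4 ^ m * 2 * \<bar>t\<bar> ^ m) * (2 ^ j * (1/3) ^ j)"
      by (simp only: mult_ac)
    also have "2 ^ j * (1/3) ^ j = (2/3 :: real) ^ j"
      unfolding power_mult_distrib[symmetric] by simp
    finally show "norm (((2 * real j + 1) * t) ^ m * (1/3) ^ j) \<le> (fact m * 4 ^ m * 2 * \<bar>t\<bar> ^ m) * (2/3) ^ j" .
  qed
qed

text \<open>The hypotheses of \<open>log_concave_geometric_tail\<close> for \<open>u\<close> and for
  \<open>- u\<close>, so that both tails decay. Only four halfspace probabilities enter, which makes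
  the condition accessible to convergence on halfspaces.\<close>

definition concentrated_on_slab :: "'a::euclidean_space measure \<Rightarrow> 'a \<Rightarrow> real \<Rightarrow> bool" where
  "concentrated_on_slab Q u t \<longleftrightarrow>
     measure Q {x. - t \<le> u \<bullet> x} \<ge> 3/4 \<and> measure Q {x. t \<le> u \<bullet> x} \<le> 1/4 \<and>
     measure Q {x. - t \<le> (- u) \<bullet> x} \<ge> 3/4 \<and> measure Q {x. t \<le> (- u) \<bullet> x} \<le> 1/4"

text \<open>\<open>C\<close> is fixed before \<open>Q\<close>, so one bound serves all log-concave
  distributions sharing the slab. It comes from shells (2 j - 1) t \<le> |u . x| \<le> (2 j + 1) t,
  on which the integrand is at most \<open>a j\<close> in the proof.\<close>

lemma log_concave_moment_bound:
  fixes u :: "'a::euclidean_space"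
  assumes t: "t > 0"
  obtains C where "C > 0"
    "\<And>Q. Q \<in> log_concave_distributions \<Longrightarrow> concentrated_on_slab Q u t \<Longrightarrow>
      integrable Q (\<lambda>x. \<bar>u \<bullet> x\<bar> ^ m) \<and> (\<integral>x. \<bar>u \<bullet> x\<bar> ^ m \<partial>Q) \<le> C"
proof -
  define a where "a j = ((2 * real j + 1) * t) ^ m" for j :: nat
  have a0: "a j \<ge> 0" for j using t by (simp add: a_def)
  have "summable (\<lambda>j. a j * (1/3) ^ j)" unfolding a_def by (rule summable_power_mult_geometric)
  then have summ: "summable (\<lambda>j. a j * (2 * (1/3) ^ j))"
    using summable_mult[of "\<lambda>j. a j * (1/3) ^ j" 2] by (simp add: mult_ac)
  \<comment> \<open>The factor 2 counts the tails in directions \<open>u\<close> and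
    \<open>- u\<close>; the summand 1 makes positivity of \<open>C\<close> immediate.\<close>
  define C where "C = 1 + (\<Sum>j. a j * (2 * (1/3) ^ j))"
  have "C > 0" using suminf_nonneg[OF summ] a0 by (simp add: C_def add_pos_nonneg)
  moreover have "integrable Q (\<lambda>x. \<bar>u \<bullet> x\<bar> ^ m) \<and> (\<integral>x. \<bar>u \<bullet> x\<bar> ^ m \<partial>Q) \<le> C"
    if Q: "Q \<in> log_concave_distributions" and conc: "concentrated_on_slab Q u t" for Q
  proof -
    interpret prob_space Q by (rule log_concave_distributions_prob_space[OF Q])
    have [measurable_cong]: "sets Q = sets borel" by (rule log_concave_distributions_prob_space[OF Q])
    let ?E = "\<lambda>v j. {x. (2 * real j - 1) * t \<le> v \<bullet> x}"
    have tail: "measure Q (?E v j) \<le> (1/3) ^ j" if "v = u \<or> v = - u" for v j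
      using conc that by (intro log_concave_geometric_tail[OF Q t]) (auto simp: concentrated_on_slab_def)
    have meas: "?E v j \<in> sets Q" for v j by measurable
    have ptw: "ennreal (\<bar>u \<bullet> x\<bar> ^ m) \<le> (\<Sum>j. ennreal (a j) * (indicator (?E u j) x + indicator (?E (- u) j) x))" for x
    proof -
      \<comment> \<open>Solving (2 j - 1) t \<le> |u . x| for j gives j \<le> z, so the integer part
        of \<open>z\<close> indexes a shell containing \<open>x\<close>. Its term alone dominates
        the integrand.\<close>
      define z where "z = (\<bar>u \<bullet> x\<bar> / t + 1) / 2"
      define j where "j = nat \<lfloor>z\<rfloor>"
      have "z \<ge> 0" using t by (simp add: z_def)
      then have "real j \<le> z" "z \<le> real j + 1" unfolding j_def by linarith+
      then have j': "(2 * real j - 1) * t \<le> \<bar>u \<bullet> x\<bar>" "\<bar>u \<bullet> x\<bar> \<le> (2 * real j + 1) * t"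
        using t by (auto simp: z_def field_simps)
      have "(1::ennreal) \<le> indicator (?E u j) x + indicator (?E (- u) j) x"
        using j'(1) by (cases "u \<bullet> x \<ge> 0") (auto simp: indicator_def)
      then have "ennreal (a j) * 1 \<le> ennreal (a j) * (indicator (?E u j) x + indicator (?E (- u) j) x)"
        by (rule mult_left_mono) simp
      also have "\<dots> \<le> (\<Sum>j. ennreal (a j) * (indicator (?E u j) x + indicator (?E (- u) j) x))"
        using sum_le_suminf[of "\<lambda>j. ennreal (a j) * (indicator (?E u j) x + indicator (?E (- u) j) x)" "{j}"]
        by simp
      finally have "ennreal (a j) \<le> (\<Sum>j. ennreal (a j) * (indicator (?E u j) x + indicator (?E (- u) j) x))"
        by simp
      moreover have "ennreal (\<bar>u \<bullet> x\<bar> ^ m) \<le> ennreal (a j)"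
        using j'(2) by (auto simp: a_def intro!: ennreal_leI power_mono)
      ultimately show ?thesis by (rule order_trans[rotated])
    qed
    have "(\<integral>\<^sup>+x. ennreal (\<bar>u \<bullet> x\<bar> ^ m) \<partial>Q)
        \<le> (\<integral>\<^sup>+x. (\<Sum>j. ennreal (a j) * (indicator (?E u j) x + indicator (?E (- u) j) x)) \<partial>Q)"
      by (rule nn_integral_mono) (rule ptw)
    also have "\<dots> = (\<Sum>j. \<integral>\<^sup>+x. ennreal (a j) * (indicator (?E u j) x + indicator (?E (- u) j) x) \<partial>Q)"
      using meas by (intro nn_integral_suminf) auto
    also have "\<dots> = (\<Sum>j. ennreal (a j) * (emeasure Q (?E u j) + emeasure Q (?E (- u) j)))"
      using meas by (simp add: nn_integral_cmult nn_integral_add)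
    also have "\<dots> \<le> (\<Sum>j. ennreal (a j * (2 * (1/3) ^ j)))"
    proof (rule suminf_le)
      fix j
      have "emeasure Q (?E u j) + emeasure Q (?E (- u) j) \<le> ennreal (2 * (1/3) ^ j)"
        using tail[of u j] tail[of "- u" j]
        by (simp add: emeasure_eq_measure ennreal_leI flip: ennreal_plus)
      then show "ennreal (a j) * (emeasure Q (?E u j) + emeasure Q (?E (- u) j)) \<le> ennreal (a j * (2 * (1/3) ^ j))"
        using a0[of j] by (simp add: ennreal_mult mult_left_mono)
    qed auto
    also have "\<dots> = ennreal (\<Sum>j. a j * (2 * (1/3) ^ j))"
      using a0 summ by (intro suminf_ennreal2) auto
    also have "\<dots> \<le> ennreal C" by (rule ennreal_leI) (simp add: C_def)
    finally have le: "(\<integral>\<^sup>+x. ennreal (\<bar>u \<bullet> x\<bar> ^ m) \<partial>Q) \<le> ennreal C" .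
    have int: "integrable Q (\<lambda>x. \<bar>u \<bullet> x\<bar> ^ m)"
      using le by (intro integrableI_nonneg) (auto intro: order_le_less_trans)
    then have "(\<integral>x. \<bar>u \<bullet> x\<bar> ^ m \<partial>Q) \<le> C"
      using le \<open>C > 0\<close> by (subst (asm) nn_integral_eq_integral) auto
    with int show ?thesis by simp
  qed
  ultimately show thesis using that by blast
qed

text \<open>The slabs |u . x| < n exhaust the space. The inequalities are strict so that they
  persist for all measures with nearby probabilities of these halfspaces.\<close>

lemma concentrated_on_slab_exists:
  fixes u :: "'a::euclidean_space"
  assumes Q: "Q \<in> log_concave_distributions"
  obtains t where "t > 0" "measure Q {x. - t \<le> u \<bullet> x} > 3/4" "measure Q {x. t \<le> u \<bullet> x} < 1/4"
    "measure Q {x. - t \<le> (- u) \<bullet> x} > 3/4" "measure Q {x. t \<le> (- u) \<bullet> x} < 1/4"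
proof -
  interpret prob_space Q by (rule log_concave_distributions_prob_space[OF Q])
  have [measurable_cong]: "sets Q = sets borel" and sp: "space Q = UNIV"
    by (rule log_concave_distributions_prob_space[OF Q])+
  define A where "A n = {x. real n \<le> \<bar>u \<bullet> x\<bar>}" for n
  have A[measurable]: "A n \<in> sets Q" for n unfolding A_def by measurable
  have "(\<lambda>n. measure Q (A n)) \<longlonglongrightarrow> measure Q (\<Inter>n. A n)"
    by (rule finite_Lim_measure_decseq) (auto simp: decseq_def A_def)
  moreover have "(\<Inter>n. A n) = {}"
  proof -
    have "\<exists>n. x \<notin> A n" for x using reals_Archimedean2[of "\<bar>u \<bullet> x\<bar>"] by (auto simp: A_def not_le)
    then show ?thesis by blast
  qed
  ultimately have "(\<lambda>n. measure Q (A n)) \<longlonglongrightarrow> 0" by simp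
  then have "eventually (\<lambda>n. measure Q (A n) < 1/4) sequentially"
    by (rule order_tendstoD) simp
  then obtain n where n: "n \<ge> 1" "measure Q (A n) < 1/4"
    using eventually_happens[OF eventually_conj[OF _ eventually_ge_at_top[of 1]]] by fastforce
  have hi: "measure Q {x. real n \<le> v \<bullet> x} < 1/4" and lo: "measure Q {x. - real n \<le> v \<bullet> x} > 3/4"
    if "v = u \<or> v = - u" for v
  proof -
    have "measure Q {x. real n \<le> v \<bullet> x} \<le> measure Q (A n)"
      using that by (intro finite_measure_mono) (auto simp: A_def)
    then show "measure Q {x. real n \<le> v \<bullet> x} < 1/4" using n by simp
    have "measure Q (space Q - A n) \<le> measure Q {x. - real n \<le> v \<bullet> x}"
      using that by (intro finite_measure_mono) (auto simp: A_def)
    then show "measure Q {x. - real n \<le> v \<bullet> x} > 3/4" using n prob_compl[OF A] by simp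
  qed
  show thesis
    using that[of "real n"] n hi[of u] hi[of "- u"] lo[of u] lo[of "- u"] by simp
qed

lemma log_concave_integrable_abs_power:
  fixes u :: "'a::euclidean_space"
  assumes Q: "Q \<in> log_concave_distributions"
  shows "integrable Q (\<lambda>x. \<bar>u \<bullet> x\<bar> ^ m)"
proof -
  obtain t where t: "t > 0" "measure Q {x. - t \<le> u \<bullet> x} > 3/4" "measure Q {x. t \<le> u \<bullet> x} < 1/4"
    "measure Q {x. - t \<le> (- u) \<bullet> x} > 3/4" "measure Q {x. t \<le> (- u) \<bullet> x} < 1/4"
    by (rule concentrated_on_slab_exists[OF Q])
  then have "concentrated_on_slab Q u t"
    unfolding concentrated_on_slab_def by (intro conjI less_imp_le)
  then show ?thesis
    using log_concave_moment_bound[OF t(1), of u m] Q by blast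
qed

lemma log_concave_integrable_power:
  fixes u :: "'a::euclidean_space"
  assumes Q: "Q \<in> log_concave_distributions"
  shows "integrable Q (\<lambda>x. (u \<bullet> x) ^ m)"
proof -
  have [measurable_cong]: "sets Q = sets borel" by (rule log_concave_distributions_prob_space[OF Q])
  show ?thesis
    using log_concave_integrable_abs_power[OF Q, of u m]
    by (rule Bochner_Integration.integrable_bound) (auto simp: power_abs)
qed

section \<open>Continuity of moments\<close>

text \<open>The neighbourhood filter of P, within the log-concave distributions, of the topology of pointwise
  convergence on closed halfspaces.\<close>

definition halfspace_nhds :: "'a::euclidean_space measure \<Rightarrow> 'a measure filter" where
  "halfspace_nhds P = inf (INF H\<in>closed_halfspaces. filtercomap (\<lambda>Q. measure Q H) (nhds (measure P H)))
     (principal log_concave_distributions)"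

lemma tendsto_measure_halfspace_nhds:
  assumes "H \<in> closed_halfspaces"
  shows "((\<lambda>Q. measure Q H) \<longlongrightarrow> measure P H) (halfspace_nhds P)"
proof (rule filterlim_mono)
  show "filterlim (\<lambda>Q. measure Q H) (nhds (measure P H)) (filtercomap (\<lambda>Q. measure Q H) (nhds (measure P H)))"
    by (rule filterlim_filtercomap)
  show "halfspace_nhds P \<le> filtercomap (\<lambda>Q. measure Q H) (nhds (measure P H))"
    unfolding halfspace_nhds_def by (intro le_infI1 INF_lower assms)
qed simp

lemma eventually_halfspace_nhds_log_concave:
  "eventually (\<lambda>Q. Q \<in> log_concave_distributions) (halfspace_nhds P)"
  unfolding halfspace_nhds_def by (simp add: eventually_inf_principal)

text \<open>An infimum of filters is generated by its finite subfamilies, so finitely many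
  halfspaces and one tolerance force an eventual property. This is where uniformity over all
  halfspaces is dispensed with.\<close>

lemma eventually_halfspace_nhdsE:
  assumes "eventually R (halfspace_nhds P)"
  obtains T \<delta> where "finite T" "T \<subseteq> closed_halfspaces" "\<delta> > 0"
    "\<forall>Q\<in>log_concave_distributions. (\<forall>H\<in>T. \<bar>measure Q H - measure P H\<bar> < \<delta>) \<longrightarrow> R Q"
proof -
  obtain T where T: "finite T" "T \<subseteq> closed_halfspaces"
    and ev: "eventually (\<lambda>Q. Q \<in> log_concave_distributions \<longrightarrow> R Q)
      (INF H\<in>T. filtercomap (\<lambda>Q. measure Q H) (nhds (measure P H)))"
    using assms unfolding halfspace_nhds_def eventually_inf_principal eventually_INF[of _ _ closed_halfspaces] by blast
  obtain S where S: "\<And>H. H \<in> T \<Longrightarrow> eventually (S H) (filtercomap (\<lambda>Q. measure Q H) (nhds (measure P H)))"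
    "\<And>Q. (\<And>H. H \<in> T \<Longrightarrow> S H Q) \<Longrightarrow> Q \<in> log_concave_distributions \<longrightarrow> R Q"
    using ev unfolding eventually_INF_finite[OF T(1)] by blast
  have "\<exists>\<delta>>0. \<forall>Q. \<bar>measure Q H - measure P H\<bar> < \<delta> \<longrightarrow> S H Q" if "H \<in> T" for H
    using S(1)[OF that] unfolding eventually_filtercomap eventually_nhds_metric dist_real_def by blast
  then obtain d where d: "\<And>H. H \<in> T \<Longrightarrow> d H > 0"
    "\<And>H Q. H \<in> T \<Longrightarrow> \<bar>measure Q H - measure P H\<bar> < d H \<Longrightarrow> S H Q" by metis
  \<comment> \<open>The inserted 1 covers the case of empty \<open>T\<close>.\<close>
  define \<delta> where "\<delta> = Min (insert 1 (d ` T))"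
  have "\<delta> > 0" and "\<And>H. H \<in> T \<Longrightarrow> \<delta> \<le> d H"
    using T(1) d(1) by (auto simp: \<delta>_def)
  then show thesis
    using that[OF T, of \<delta>] S(2) d(2) by (meson order_less_le_trans)
qed

section \<open>Approximating moments by halfspace probabilities\<close>

lemma closed_halfspace_ge_mem:
  assumes "u \<noteq> 0"
  shows "{x. t \<le> u \<bullet> x} \<in> closed_halfspaces"
proof -
  have "{x. t \<le> u \<bullet> x} = {x. (- u) \<bullet> x \<le> - t}" by auto
  then show ?thesis unfolding closed_halfspaces_def using assms by (auto intro!: exI[of _ "- u"] exI[of _ "- t"])
qed

text \<open>The cells are half-open so that their indicators are differences of indicators of closed
  half-lines. Composed with a nonzero linear form these become closed halfspaces, and the step
  function integrates to a combination of their probabilities.\<close>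

lemma uniform_step_function:
  fixes R e :: real
  assumes "R > 0" "e > 0"
  obtains N :: nat and s where
    "\<And>y. - R \<le> y \<Longrightarrow> y < R \<Longrightarrow>
      \<bar>y ^ k - (\<Sum>j<N. s j ^ k * (indicator {s j..} y - indicator {s (Suc j)..} y))\<bar> \<le> e"
    "\<And>y. y < - R \<or> R \<le> y \<Longrightarrow>
      (\<Sum>j<N. s j ^ k * (indicator {s j..} y - indicator {s (Suc j)..} y)) = 0"
proof -
  have "uniformly_continuous_on {-R..R} (\<lambda>y. y ^ k)"
    by (intro compact_uniformly_continuous continuous_intros) auto
  then obtain d where d: "d > 0"
    "\<And>x y. x \<in> {-R..R} \<Longrightarrow> y \<in> {-R..R} \<Longrightarrow> \<bar>y - x\<bar> < d \<Longrightarrow> \<bar>y ^ k - x ^ k\<bar> < e"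
    using \<open>e > 0\<close> unfolding uniformly_continuous_on_def dist_real_def by metis
  obtain N :: nat where N: "2 * R / d < real N" using reals_Archimedean2 by blast
  have N0: "N > 0"
  proof (rule ccontr)
    assume "\<not> N > 0"
    then show False using N assms d(1) by (simp add: divide_less_0_iff)
  qed
  \<comment> \<open>\<open>N\<close> exceeds \<open>2 * R / d\<close>, so the mesh \<open>w\<close>
    is below the \<open>d\<close> of uniform continuity.\<close>
  define w where "w = 2 * R / real N"
  have w: "w > 0" "w < d" "real N * w = 2 * R"
    using N N0 assms d(1) by (auto simp: w_def field_simps)
  define s where "s j = - R + real j * w" for j :: nat
  have sN: "s N = R" and s0: "s 0 = - R" using w by (auto simp: s_def)
  have mono: "s i \<le> s j" if "i \<le> j" for i j using that w by (simp add: s_def)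
  have ind: "(indicator {s j..} y - indicator {s (Suc j)..} y :: real) = indicator {s j..<s (Suc j)} y" for j y
    using mono[of j "Suc j"] by (auto simp: indicator_def)
  show thesis
  proof (rule that[of s N])
    fix y assume y: "- R \<le> y" "y < R"
    define i where "i = nat \<lfloor>(y + R) / w\<rfloor>"
    have z: "(y + R) / w \<ge> 0" using y w by simp
    then have "real i \<le> (y + R) / w" "(y + R) / w < real i + 1" unfolding i_def by linarith+
    then have si: "s i \<le> y" "y < s (Suc i)"
      using w by (auto simp: s_def field_simps)
    have "i < N"
    proof (rule ccontr)
      assume "\<not> i < N"
      then show False using mono[of N i] si y sN by simp
    qed
    have "(\<Sum>j<N. s j ^ k * (indicator {s j..} y - indicator {s (Suc j)..} y)) = (\<Sum>j<N. if j = i then s i ^ k else 0)"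
    proof (rule sum.cong)
      fix j assume "j \<in> {..<N}"
      show "s j ^ k * (indicator {s j..} y - indicator {s (Suc j)..} y) = (if j = i then s i ^ k else 0)"
      proof (cases "j = i")
        case False
        then have "Suc j \<le> i \<or> Suc i \<le> j" by auto
        then have "y \<notin> {s j..<s (Suc j)}"
          using mono[of "Suc j" i] mono[of "Suc i" j] si by auto
        with False show ?thesis by (simp add: ind)
      qed (use si in \<open>simp add: ind\<close>)
    qed simp
    also have "\<dots> = s i ^ k" using \<open>i < N\<close> by simp
    finally have eq: "(\<Sum>j<N. s j ^ k * (indicator {s j..} y - indicator {s (Suc j)..} y)) = s i ^ k" .
    have "\<bar>y - s i\<bar> < d" using si w by (simp add: s_def algebra_simps)
    moreover have "s i \<in> {-R..R}" using si y mono[of 0 i] s0 by auto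
    ultimately show "\<bar>y ^ k - (\<Sum>j<N. s j ^ k * (indicator {s j..} y - indicator {s (Suc j)..} y))\<bar> \<le> e"
      unfolding eq using d(2)[of "s i" y] y by auto
  next
    fix y assume y: "y < - R \<or> R \<le> y"
    have "s j ^ k * (indicator {s j..} y - indicator {s (Suc j)..} y) = 0" if "j < N" for j
    proof -
      have "- R \<le> s j" "s (Suc j) \<le> R" using mono[of 0 j] mono[of "Suc j" N] that s0 sN by auto
      then show ?thesis using y by (auto simp: ind)
    qed
    then show "(\<Sum>j<N. s j ^ k * (indicator {s j..} y - indicator {s (Suc j)..} y)) = 0"
      by (intro sum.neutral) auto
  qed
qed

text \<open>The power is replaced by a step function vanishing beyond R, and the moment of order k +
  1, bounded uniformly near \<open>P\<close>, controls what is cut off. Errors of \<epsilon> / 4 for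
  \<open>Q\<close>, \<epsilon> / 4 for \<open>P\<close> and \<epsilon> / 2 for the finite
  combination of probabilities add up to \<epsilon>.\<close>

lemma tendsto_ridge_moment:
  fixes u :: "'a::euclidean_space"
  assumes P: "P \<in> log_concave_distributions"
  shows "((\<lambda>Q. \<integral>x. (u \<bullet> x) ^ k \<partial>Q) \<longlongrightarrow> (\<integral>x. (u \<bullet> x) ^ k \<partial>P)) (halfspace_nhds P)"
proof (cases "u = 0")
  \<comment> \<open>For \<open>u = 0\<close> the sets \<open>{x. a \<le> u \<bullet> x}\<close> are
    not halfspaces, but the integrand is constant.\<close>
  case True
  have "(\<integral>x. (u \<bullet> x) ^ k \<partial>Q) = 0 ^ k" if "Q \<in> log_concave_distributions" for Q
  proof -
    interpret prob_space Q by (rule log_concave_distributions_prob_space[OF that])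
    show ?thesis using True by (simp add: prob_space)
  qed
  then have "eventually (\<lambda>Q. (\<integral>x. (u \<bullet> x) ^ k \<partial>Q) = (\<integral>x. (u \<bullet> x) ^ k \<partial>P)) (halfspace_nhds P)"
    using eventually_halfspace_nhds_log_concave[of P] P by (auto elim: eventually_mono)
  then show ?thesis by (rule tendsto_eventually)
next
  case u: False
  show ?thesis
  proof (rule tendstoI)
    fix \<epsilon> :: real assume "\<epsilon> > 0"
    obtain t where t: "t > 0" "measure P {x. - t \<le> u \<bullet> x} > 3/4" "measure P {x. t \<le> u \<bullet> x} < 1/4"
      "measure P {x. - t \<le> (- u) \<bullet> x} > 3/4" "measure P {x. t \<le> (- u) \<bullet> x} < 1/4"
      by (rule concentrated_on_slab_exists[OF P])
    have mem: "{x. a \<le> u \<bullet> x} \<in> closed_halfspaces" "{x. a \<le> (- u) \<bullet> x} \<in> closed_halfspaces" for a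
      using u by (intro closed_halfspace_ge_mem, simp)+
    have conc: "eventually (\<lambda>Q. concentrated_on_slab Q u t) (halfspace_nhds P)"
      unfolding concentrated_on_slab_def
      using order_tendstoD(1)[OF tendsto_measure_halfspace_nhds[OF mem(1)] t(2)]
        order_tendstoD(2)[OF tendsto_measure_halfspace_nhds[OF mem(1)] t(3)]
        order_tendstoD(1)[OF tendsto_measure_halfspace_nhds[OF mem(2)] t(4)]
        order_tendstoD(2)[OF tendsto_measure_halfspace_nhds[OF mem(2)] t(5)]
      by eventually_elim auto
    have concP: "concentrated_on_slab P u t"
      using t unfolding concentrated_on_slab_def by (intro conjI less_imp_le)
    obtain C where C: "C > 0" "\<And>Q. Q \<in> log_concave_distributions \<Longrightarrow> concentrated_on_slab Q u t \<Longrightarrow>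
      integrable Q (\<lambda>x. \<bar>u \<bullet> x\<bar> ^ Suc k) \<and> (\<integral>x. \<bar>u \<bullet> x\<bar> ^ Suc k \<partial>Q) \<le> C"
      using log_concave_moment_bound[OF t(1)] by blast
    \<comment> \<open>Where |u . x| \<ge> R, the power k is at most the power k + 1 divided by R,
      whose integral is at most C / R = \<epsilon> / 8.\<close>
    define R where "R = 8 * C / \<epsilon>"
    have R: "R > 0" "C / R = \<epsilon> / 8" using C(1) \<open>\<epsilon> > 0\<close> by (auto simp: R_def)
    obtain N :: nat and s where
      near: "\<And>y. - R \<le> y \<Longrightarrow> y < R \<Longrightarrow>
        \<bar>y ^ k - (\<Sum>j<N. s j ^ k * (indicator {s j..} y - indicator {s (Suc j)..} y))\<bar> \<le> \<epsilon> / 8" and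
      far: "\<And>y. y < - R \<or> R \<le> y \<Longrightarrow>
        (\<Sum>j<N. s j ^ k * (indicator {s j..} y - indicator {s (Suc j)..} y)) = 0"
      by (rule uniform_step_function[OF R(1), of "\<epsilon> / 8" k]) (use \<open>\<epsilon> > 0\<close> in simp, blast)
    define g where "g x = (\<Sum>j<N. s j ^ k * (indicator {x. s j \<le> u \<bullet> x} x - indicator {x. s (Suc j) \<le> u \<bullet> x} x))"
      for x :: 'a
    have g_eq: "g x = (\<Sum>j<N. s j ^ k * (indicator {s j..} (u \<bullet> x) - indicator {s (Suc j)..} (u \<bullet> x)))" for x
      by (simp add: g_def indicator_def)
    have ptw: "\<bar>(u \<bullet> x) ^ k - g x\<bar> \<le> \<epsilon> / 8 + \<bar>u \<bullet> x\<bar> ^ Suc k / R" for x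
    proof (cases "- R \<le> u \<bullet> x \<and> u \<bullet> x < R")
      case True
      then have "\<bar>(u \<bullet> x) ^ k - g x\<bar> \<le> \<epsilon> / 8" unfolding g_eq using near by blast
      then show ?thesis using R(1) by (simp add: add_increasing2)
    next
      case False
      then have "R \<le> \<bar>u \<bullet> x\<bar>" by auto
      then have "\<bar>u \<bullet> x\<bar> ^ k * R \<le> \<bar>u \<bullet> x\<bar> ^ k * \<bar>u \<bullet> x\<bar>" by (intro mult_left_mono) auto
      then have "\<bar>u \<bullet> x\<bar> ^ k \<le> \<bar>u \<bullet> x\<bar> ^ Suc k / R" using R(1) by (simp add: field_simps)
      moreover have "g x = 0" unfolding g_eq using False by (intro far) auto
      ultimately show ?thesis using \<open>\<epsilon> > 0\<close> by (simp add: power_abs)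
    qed
    have int_g: "integrable Q g" "(\<integral>x. g x \<partial>Q) =
        (\<Sum>j<N. s j ^ k * (measure Q {x. s j \<le> u \<bullet> x} - measure Q {x. s (Suc j) \<le> u \<bullet> x}))"
      if "Q \<in> log_concave_distributions" for Q
    proof -
      interpret prob_space Q by (rule log_concave_distributions_prob_space[OF that])
      have [measurable_cong]: "sets Q = sets borel" by (rule log_concave_distributions_prob_space[OF that])
      have [measurable]: "{x. a \<le> u \<bullet> x} \<in> sets Q" for a by measurable
      have [simp]: "integrable Q (indicator {x. a \<le> u \<bullet> x} :: 'a \<Rightarrow> real)" for a
        by (rule integrable_real_indicator) (auto simp: emeasure_eq_measure)
      show "integrable Q g" unfolding g_def[abs_def] by simp
      show "(\<integral>x. g x \<partial>Q) =
        (\<Sum>j<N. s j ^ k * (measure Q {x. s j \<le> u \<bullet> x} - measure Q {x. s (Suc j) \<le> u \<bullet> x}))"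
        unfolding g_def[abs_def] by (simp add: log_concave_distributions_prob_space(3)[OF that])
    qed
    have approx: "\<bar>(\<integral>x. (u \<bullet> x) ^ k \<partial>Q) - (\<integral>x. g x \<partial>Q)\<bar> \<le> \<epsilon> / 4"
      if Q: "Q \<in> log_concave_distributions" and conc: "concentrated_on_slab Q u t" for Q
    proof -
      interpret prob_space Q by (rule log_concave_distributions_prob_space[OF Q])
      note int = log_concave_integrable_power[OF Q, of u k] int_g(1)[OF Q]
      have "\<bar>(\<integral>x. (u \<bullet> x) ^ k \<partial>Q) - (\<integral>x. g x \<partial>Q)\<bar> = \<bar>\<integral>x. (u \<bullet> x) ^ k - g x \<partial>Q\<bar>"
        using int by simp
      also have "\<dots> \<le> (\<integral>x. \<bar>(u \<bullet> x) ^ k - g x\<bar> \<partial>Q)" by (rule integral_abs_bound)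
      also have "\<dots> \<le> (\<integral>x. \<epsilon> / 8 + \<bar>u \<bullet> x\<bar> ^ Suc k / R \<partial>Q)"
        using int C(2)[OF Q conc] by (intro integral_mono ptw) (auto simp del: power_Suc)
      also have "\<dots> = \<epsilon> / 8 + (\<integral>x. \<bar>u \<bullet> x\<bar> ^ Suc k \<partial>Q) / R"
        using C(2)[OF Q conc] by (simp add: prob_space del: power_Suc)
      also have "\<dots> \<le> \<epsilon> / 8 + C / R"
        using C(2)[OF Q conc] R(1) by (intro add_left_mono divide_right_mono) auto
      finally show ?thesis using R(2) by simp
    qed
    have "((\<lambda>Q. \<Sum>j<N. s j ^ k * (measure Q {x. s j \<le> u \<bullet> x} - measure Q {x. s (Suc j) \<le> u \<bullet> x})) \<longlongrightarrow>
        (\<Sum>j<N. s j ^ k * (measure P {x. s j \<le> u \<bullet> x} - measure P {x. s (Suc j) \<le> u \<bullet> x}))) (halfspace_nhds P)"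
      by (intro tendsto_intros tendsto_measure_halfspace_nhds mem)
    then have "eventually (\<lambda>Q. dist (\<Sum>j<N. s j ^ k * (measure Q {x. s j \<le> u \<bullet> x} - measure Q {x. s (Suc j) \<le> u \<bullet> x}))
        (\<Sum>j<N. s j ^ k * (measure P {x. s j \<le> u \<bullet> x} - measure P {x. s (Suc j) \<le> u \<bullet> x})) < \<epsilon> / 2) (halfspace_nhds P)"
      by (rule tendstoD) (use \<open>\<epsilon> > 0\<close> in simp)
    then show "eventually (\<lambda>Q. dist (\<integral>x. (u \<bullet> x) ^ k \<partial>Q) (\<integral>x. (u \<bullet> x) ^ k \<partial>P) < \<epsilon>) (halfspace_nhds P)"
      using conc eventually_halfspace_nhds_log_concave
    proof eventually_elim
      case (elim Q)
      then show ?case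
        using approx[OF elim(3,2)] approx[OF P concP]
        unfolding dist_real_def int_g(2)[OF elim(3), symmetric] int_g(2)[OF P, symmetric] by linarith
    qed
  qed
qed

text \<open>Integrability travels along because the step for sums rests on additivity of the
  integral.\<close>

lemma ridge_span_integral:
  assumes "p \<in> ridge_span" and P: "P \<in> log_concave_distributions"
  shows "(\<forall>Q\<in>log_concave_distributions. integrable Q p) \<and>
    ((\<lambda>Q. \<integral>x. p x \<partial>Q) \<longlongrightarrow> (\<integral>x. p x \<partial>P)) (halfspace_nhds P)"
  using assms(1)
proof induction
  case (power u k)
  show ?case using log_concave_integrable_power tendsto_ridge_moment[OF P] by blast
next
  case (add f g)
  have "((\<lambda>Q. (\<integral>x. f x \<partial>Q) + (\<integral>x. g x \<partial>Q)) \<longlongrightarrow> (\<integral>x. f x \<partial>P) + (\<integral>x. g x \<partial>P)) (halfspace_nhds P)"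
    using add.IH by (intro tendsto_add) auto
  moreover have "eventually (\<lambda>Q. (\<integral>x. f x \<partial>Q) + (\<integral>x. g x \<partial>Q) = (\<integral>x. f x + g x \<partial>Q)) (halfspace_nhds P)"
    using eventually_halfspace_nhds_log_concave by eventually_elim (use add.IH in auto)
  ultimately show ?case
    using add.IH P by (auto intro: Lim_transform_eventually)
next
  case (scale f c)
  then show ?case by (auto intro: tendsto_mult_left)
qed

section \<open>Confidence sets\<close>

lemma halfspace_dist_commute: "halfspace_dist P Q = halfspace_dist Q P"
  by (simp add: halfspace_dist_def abs_minus_commute)

text \<open>A supremum of reals is known to bound its members only for a bounded family, which the
  bounds by 1 ensure.\<close>

lemma measure_diff_le_halfspace_dist:
  assumes "H \<in> closed_halfspaces" "\<And>H. measure P H \<le> 1" "\<And>H. measure Q H \<le> 1"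
  shows "\<bar>measure P H - measure Q H\<bar> \<le> halfspace_dist P Q"
  unfolding halfspace_dist_def
proof (rule cSUP_upper[OF assms(1)])
  have "\<bar>measure P H - measure Q H\<bar> \<le> 1" for H
    using assms(2,3)[of H] measure_nonneg[of P H] measure_nonneg[of Q H] by linarith
  then show "bdd_above ((\<lambda>H. \<bar>measure P H - measure Q H\<bar>) ` closed_halfspaces)" by (auto simp: bdd_above_def)
qed

text \<open>Allows a sample sequence to be exchanged with its restriction to the first n indices, a
  point of the product space.\<close>

lemma empirical_distribution_cong:
  assumes "\<And>i. i < n \<Longrightarrow> x i = y i"
  shows "empirical_distribution n x = empirical_distribution n y"
proof -
  have "(\<Sum>i<n. emeasure (return borel (x i)) A) = (\<Sum>i<n. emeasure (return borel (y i)) A)" for A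
    using assms by (intro sum.cong) auto
  then show ?thesis by (simp add: empirical_distribution_def)
qed

lemma measure_empirical_distribution:
  assumes "n \<ge> 1" "A \<in> sets borel"
  shows "measure (empirical_distribution n x) A = (\<Sum>i<n. indicator A (x i)) / real n"
proof -
  have "emeasure (empirical_distribution n x) A = (\<Sum>i<n. ennreal (indicator A (x i))) / ennreal (real n)"
    using assms(2) by (simp add: emeasure_empirical_distribution ennreal_indicator ennreal_of_nat_eq_real_of_nat)
  also have "\<dots> = ennreal ((\<Sum>i<n. indicator A (x i)) / real n)"
    using assms(1) by (simp add: divide_ennreal sum_nonneg)
  finally show ?thesis by (simp add: measure_def sum_nonneg)
qed

lemma measure_empirical_distribution_le_1:
  assumes "n \<ge> 1"
  shows "measure (empirical_distribution n x) A \<le> 1"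
proof (cases "A \<in> sets borel")
  case True
  have "(\<Sum>i<n. indicator A (x i)) \<le> (\<Sum>i<n. 1 :: real)"
    by (intro sum_mono) (simp add: indicator_def)
  then show ?thesis using assms by (simp add: measure_empirical_distribution[OF assms True])
next
  case False
  then show ?thesis by (simp add: measure_notin_sets)
qed

lemma closed_halfspaces_borel: "H \<in> closed_halfspaces \<Longrightarrow> H \<in> sets borel"
  by (auto simp: closed_halfspaces_def intro!: borel_closed closed_halfspace_le)

text \<open>Hoeffding's inequality for the indicators of \<open>H\<close>, with values in [0, 1].
  Measurability is part of the conclusion for the sake of the union bound in the consistency
  proof.\<close>

lemma (in prob_space) empirical_measure_deviation:
  fixes X :: "nat \<Rightarrow> 'a \<Rightarrow> 'b::euclidean_space"
  assumes indep: "indep_vars (\<lambda>_. borel) X UNIV" and distr: "\<And>i. distr M borel (X i) = P"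
    and H: "H \<in> sets borel" and \<delta>: "\<delta> > 0" and n: "n \<ge> 1"
  shows "{\<omega> \<in> space M. \<bar>measure (empirical_distribution n (\<lambda>i. X i \<omega>)) H - measure P H\<bar> \<ge> \<delta>} \<in> sets M"
    "prob {\<omega> \<in> space M. \<bar>measure (empirical_distribution n (\<lambda>i. X i \<omega>)) H - measure P H\<bar> \<ge> \<delta>}
      \<le> 2 * exp (- 2 * \<delta>\<^sup>2) ^ n"
proof -
  note [measurable] = H
  have X[measurable]: "X i \<in> M \<rightarrow>\<^sub>M borel" for i using indep by (simp add: indep_vars_def)
  have exp_ind: "expectation (\<lambda>\<omega>. indicator H (X i \<omega>)) = measure P H" for i
  proof -
    have "measure P H = measure (distr M borel (X i)) H" by (simp add: distr)
    also have "\<dots> = (\<integral>\<omega>. indicator H \<omega> \<partial>distr M borel (X i))" by simp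
    also have "\<dots> = expectation (\<lambda>\<omega>. indicator H (X i \<omega>))" by (rule integral_distr) auto
    finally show ?thesis by simp
  qed
  interpret Hoeffding_ineq M "{..<n}" "\<lambda>i \<omega>. indicator H (X i \<omega>) :: real" "\<lambda>_. 0" "\<lambda>_. 1"
    "\<Sum>i<n. expectation (\<lambda>\<omega>. indicator H (X i \<omega>))"
  proof unfold_locales
    show "indep_vars (\<lambda>_. borel) (\<lambda>i \<omega>. indicator H (X i \<omega>) :: real) {..<n}"
      by (rule indep_vars_compose2[OF indep_vars_subset[OF indep]]) auto
  qed auto
  have eq: "{\<omega> \<in> space M. \<bar>measure (empirical_distribution n (\<lambda>i. X i \<omega>)) H - measure P H\<bar> \<ge> \<delta>}
    = {\<omega> \<in> space M. \<bar>(\<Sum>i<n. indicator H (X i \<omega>)) - (\<Sum>i<n. expectation (\<lambda>\<omega>. indicator H (X i \<omega>)))\<bar> \<ge> real n * \<delta>}"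
  proof -
    have "\<bar>s / real n - q\<bar> \<ge> \<delta> \<longleftrightarrow> \<bar>s - real n * q\<bar> \<ge> real n * \<delta>" for s q :: real
    proof -
      have "s - real n * q = real n * (s / real n - q)" using n by (simp add: right_diff_distrib)
      then have "\<bar>s - real n * q\<bar> = real n * \<bar>s / real n - q\<bar>" by (simp add: abs_mult)
      then show ?thesis using n by simp
    qed
    then show ?thesis using n by (simp add: measure_empirical_distribution exp_ind)
  qed
  show "{\<omega> \<in> space M. \<bar>measure (empirical_distribution n (\<lambda>i. X i \<omega>)) H - measure P H\<bar> \<ge> \<delta>} \<in> sets M"
    unfolding eq by measurable
  have "prob {\<omega> \<in> space M. \<bar>(\<Sum>i<n. indicator H (X i \<omega>)) - (\<Sum>i<n. expectation (\<lambda>\<omega>. indicator H (X i \<omega>)))\<bar> \<ge> real n * \<delta>}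
      \<le> 2 * exp (-2 * (real n * \<delta>)\<^sup>2 / (\<Sum>i<n. (1 - 0)\<^sup>2))"
    by (rule Hoeffding_ineq_abs_ge) (use n \<delta> in auto)
  \<comment> \<open>The n ranges of length 1 contribute n to the denominator, so the exponent is
    linear in n.\<close>
  also have "-2 * (real n * \<delta>)\<^sup>2 / (\<Sum>i<n. (1 - 0)\<^sup>2) = real n * (- 2 * \<delta>\<^sup>2)"
    using n by (simp add: power2_eq_square)
  also have "exp (real n * (- 2 * \<delta>\<^sup>2)) = exp (- 2 * \<delta>\<^sup>2) ^ n" by (rule exp_of_nat_mult)
  finally show "prob {\<omega> \<in> space M. \<bar>measure (empirical_distribution n (\<lambda>i. X i \<omega>)) H - measure P H\<bar> \<ge> \<delta>}
      \<le> 2 * exp (- 2 * \<delta>\<^sup>2) ^ n"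
    unfolding eq .
qed

text \<open>The hypothesis on \<open>c\<close> is about outer probability on the product space, the
  claim about events of \<open>M\<close>. By independence the first n variables have the product
  law, so a measurable cover of the bad set can be pulled back to \<open>M\<close> without change of
  probability.\<close>

lemma confidence_set_coverage:
  fixes P :: "'a::euclidean_space measure"
  assumes c: "outer_measure_of (\<Pi>\<^sub>M i\<in>{..<n}. P)
        {x \<in> space (\<Pi>\<^sub>M i\<in>{..<n}. P).
           halfspace_dist (empirical_distribution n x) P \<ge> c / sqrt (real n)} \<le> ennreal \<alpha>"
    and \<alpha>: "0 \<le> \<alpha>"
    and P: "P \<in> log_concave_distributions"
    and M: "prob_space M"
    and indep: "prob_space.indep_vars M (\<lambda>_. borel) X UNIV"
    and distr: "\<And>i. distr M borel (X i) = P"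
    and n: "n \<ge> 1"
  obtains B where "B \<in> sets M" "emeasure M B \<ge> ennreal (1 - \<alpha>)"
    "\<And>\<omega>. \<omega> \<in> B \<Longrightarrow> P \<in> confidence_set c n (\<lambda>i. X i \<omega>)"
proof -
  interpret prob_space M by fact
  let ?I = "{..<n}" and ?T = "\<lambda>\<omega>. \<lambda>i\<in>{..<n}. X i \<omega>"
  let ?PM = "\<Pi>\<^sub>M i\<in>?I. P" and ?B = "\<Pi>\<^sub>M i\<in>?I. (borel :: 'a measure)"
  have X[measurable]: "X i \<in> M \<rightarrow>\<^sub>M borel" for i using indep by (simp add: indep_vars_def)
  have "indep_vars (\<lambda>_. borel) X ?I" by (rule indep_vars_subset[OF indep]) simp
  then have "distr M ?B ?T = (\<Pi>\<^sub>M i\<in>?I. distr M borel (X i))"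
    using n by (subst (asm) indep_vars_iff_distr_eq_PiM') (auto simp: lessThan_empty_iff)
  then have T_distr: "distr M ?B ?T = ?PM" by (simp add: distr)
  have sets_PM: "sets ?PM = sets ?B"
    using log_concave_distributions_prob_space(2)[OF P] by (intro sets_PiM_cong) auto
  let ?bad = "{x \<in> space ?PM. halfspace_dist (empirical_distribution n x) P \<ge> c / sqrt (real n)}"
  obtain E where E: "E \<in> sets ?PM" "?bad \<subseteq> E" "outer_measure_of ?PM ?bad = emeasure ?PM E"
    using outer_measure_of_attain[of ?bad ?PM] by auto
  have T[measurable]: "?T \<in> M \<rightarrow>\<^sub>M ?B" by measurable
  let ?F = "?T -` E \<inter> space M"
  have F: "?F \<in> sets M" using T E(1) unfolding sets_PM by (rule measurable_sets)
  have "emeasure M ?F = emeasure (distr M ?B ?T) E"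
    using E(1) unfolding sets_PM by (intro emeasure_distr[symmetric] T)
  also have "\<dots> \<le> ennreal \<alpha>" using c E(3) unfolding T_distr by simp
  finally have "prob ?F \<le> \<alpha>" using \<alpha> by (simp add: emeasure_eq_measure)
  then have "emeasure M (space M - ?F) \<ge> ennreal (1 - \<alpha>)"
    using prob_compl[OF F] by (simp add: emeasure_eq_measure ennreal_leI)
  moreover have "P \<in> confidence_set c n (\<lambda>i. X i \<omega>)" if \<omega>: "\<omega> \<in> space M - ?F" for \<omega>
  proof -
    have "?T \<omega> \<in> space ?PM"
      unfolding sets_eq_imp_space_eq[OF sets_PM] using \<omega> measurable_space[OF T] by blast
    moreover have "?T \<omega> \<notin> ?bad" using \<omega> E(2) by blast
    moreover have "empirical_distribution n (?T \<omega>) = empirical_distribution n (\<lambda>i. X i \<omega>)"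
      by (rule empirical_distribution_cong) simp
    ultimately show ?thesis
      using P by (simp add: confidence_set_def halfspace_dist_commute[of P])
  qed
  ultimately show thesis using that[of "space M - ?F"] F by blast
qed

text \<open>On each of the finitely many test halfspaces, \<open>Q\<close> is close to the empirical
  distribution by membership in the confidence set, and the latter is close to \<open>P\<close> off
  an event that does not depend on \<open>Q\<close>. This gives uniformity over the whole confidence
  set.\<close>

lemma integral_confidence_set_consistent:
  fixes P :: "'a::euclidean_space measure"
  assumes P: "P \<in> log_concave_distributions"
    and M: "prob_space M"
    and indep: "prob_space.indep_vars M (\<lambda>_. borel) X UNIV"
    and distr: "\<And>i. distr M borel (X i) = P"
    and p: "real_polynomial_function p"
  shows "tends_to_0_in_outer_prob M
    (\<lambda>n \<omega>. SUP t\<in>integral_confidence_set c n (\<lambda>i. X i \<omega>) p. ennreal \<bar>t - (\<integral>y. p y \<partial>P)\<bar>)"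
  unfolding tends_to_0_in_outer_prob_def
proof (intro allI impI)
  fix \<epsilon> :: real assume "\<epsilon> > 0"
  interpret prob_space M by fact
  let ?S = "\<lambda>n \<omega>. SUP t\<in>integral_confidence_set c n (\<lambda>i. X i \<omega>) p. ennreal \<bar>t - (\<integral>y. p y \<partial>P)\<bar>"
  have "((\<lambda>Q. \<integral>x. p x \<partial>Q) \<longlongrightarrow> (\<integral>x. p x \<partial>P)) (halfspace_nhds P)"
    using ridge_span_integral[OF real_polynomial_function_in_ridge_span[OF p] P] by blast
  then have "eventually (\<lambda>Q. dist (\<integral>x. p x \<partial>Q) (\<integral>x. p x \<partial>P) < \<epsilon>) (halfspace_nhds P)"
    using \<open>\<epsilon> > 0\<close> by (rule tendstoD)
  then obtain T \<delta> where T: "finite T" "T \<subseteq> closed_halfspaces" and \<delta>: "\<delta> > 0"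
    and close: "\<forall>Q\<in>log_concave_distributions.
      (\<forall>H\<in>T. \<bar>measure Q H - measure P H\<bar> < \<delta>) \<longrightarrow> dist (\<integral>x. p x \<partial>Q) (\<integral>x. p x \<partial>P) < \<epsilon>"
    by (rule eventually_halfspace_nhdsE)
  \<comment> \<open>Half the tolerance is for the sampling error; the other half absorbs
    \<open>c / sqrt (real n)\<close>.\<close>
  define A where "A n H = {\<omega> \<in> space M.
      \<bar>measure (empirical_distribution n (\<lambda>i. X i \<omega>)) H - measure P H\<bar> \<ge> \<delta> / 2}" for n H
  have A: "A n H \<in> sets M" "prob (A n H) \<le> 2 * exp (- 2 * (\<delta> / 2)\<^sup>2) ^ n" if "H \<in> T" "n \<ge> 1" for n H
    unfolding A_def using empirical_measure_deviation[OF indep distr _ _ that(2), of H "\<delta> / 2"]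
      T(2) that(1) \<delta> by (auto intro: closed_halfspaces_borel)
  define b where "b n = real (card T) * (2 * exp (- 2 * (\<delta> / 2)\<^sup>2) ^ n)" for n
  have "(\<lambda>n. c / sqrt (real n)) \<longlonglongrightarrow> 0"
    by (intro real_tendsto_divide_at_top[OF tendsto_const] filterlim_compose[OF sqrt_at_top] filterlim_real_sequentially)
  then have "eventually (\<lambda>n. c / sqrt (real n) < \<delta> / 2) sequentially"
    by (rule order_tendstoD) (use \<delta> in simp)
  then have bound: "eventually (\<lambda>n. outer_measure_of M {\<omega> \<in> space M. ?S n \<omega> > ennreal \<epsilon>} \<le> ennreal (b n)) sequentially"
    using eventually_ge_at_top[of 1]
  proof eventually_elim
    case (elim n)
    have sub: "{\<omega> \<in> space M. ?S n \<omega> > ennreal \<epsilon>} \<subseteq> (\<Union>H\<in>T. A n H)"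
    proof (rule ccontr)
      assume "\<not> ?thesis"
      then obtain \<omega> where \<omega>: "\<omega> \<in> space M" "?S n \<omega> > ennreal \<epsilon>" "\<And>H. H \<in> T \<Longrightarrow> \<omega> \<notin> A n H" by blast
      let ?E = "empirical_distribution n (\<lambda>i. X i \<omega>)"
      have "?S n \<omega> \<le> ennreal \<epsilon>"
      \<comment> \<open>An empty confidence set is covered as well: the supremum in
        \<open>ennreal\<close> is then 0.\<close>
      proof (rule SUP_least)
        fix t assume "t \<in> integral_confidence_set c n (\<lambda>i. X i \<omega>) p"
        then obtain Q where t: "t = (\<integral>y. p y \<partial>Q)" and Q: "Q \<in> log_concave_distributions"
          and dQ: "halfspace_dist Q ?E \<le> c / sqrt (real n)"
          by (auto simp: integral_confidence_set_def confidence_set_def)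
        interpret Q: prob_space Q by (rule log_concave_distributions_prob_space[OF Q])
        have "dist (\<integral>x. p x \<partial>Q) (\<integral>x. p x \<partial>P) < \<epsilon>"
        proof (rule close[rule_format, OF Q])
          fix H assume "H \<in> T"
          then have "\<bar>measure Q H - measure ?E H\<bar> \<le> halfspace_dist Q ?E"
            using T(2) measure_empirical_distribution_le_1[OF elim(2)]
            by (intro measure_diff_le_halfspace_dist) auto
          moreover have "\<bar>measure ?E H - measure P H\<bar> < \<delta> / 2"
            using \<omega>(1,3) \<open>H \<in> T\<close> by (auto simp: A_def not_le)
          ultimately show "\<bar>measure Q H - measure P H\<bar> < \<delta>" using dQ elim(1) by linarith
        qed
        then show "ennreal \<bar>t - (\<integral>y. p y \<partial>P)\<bar> \<le> ennreal \<epsilon>"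
          by (intro ennreal_leI) (simp add: t dist_real_def)
      qed
      then show False using \<omega>(2) by simp
    qed
    have meas: "(\<Union>H\<in>T. A n H) \<in> sets M" using T(1) A(1) elim(2) by (intro sets.finite_UN) auto
    have "outer_measure_of M {\<omega> \<in> space M. ?S n \<omega> > ennreal \<epsilon>} \<le> emeasure M (\<Union>H\<in>T. A n H)"
      using outer_measure_of_mono[OF sub, of M] outer_measure_of_eq[OF meas] by simp
    also have "\<dots> = ennreal (prob (\<Union>H\<in>T. A n H))" by (rule emeasure_eq_measure)
    also have "prob (\<Union>H\<in>T. A n H) \<le> (\<Sum>H\<in>T. prob (A n H))"
      using T(1) A(1) elim(2) by (intro measure_UNION_le) auto
    also have "\<dots> \<le> b n"
      unfolding b_def using A(2) elim(2) by (intro sum_bounded_above) auto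
    finally show ?case by (simp add: ennreal_leI)
  qed
  have lim: "(\<lambda>n. ennreal (b n)) \<longlonglongrightarrow> 0"
  proof -
    have "(\<lambda>n. exp (- 2 * (\<delta> / 2)\<^sup>2) ^ n) \<longlonglongrightarrow> 0"
      using \<delta> by (intro LIMSEQ_power_zero) simp
    then have "b \<longlonglongrightarrow> real (card T) * (2 * 0)"
      unfolding b_def[abs_def] by (intro tendsto_mult_left)
    then have "(\<lambda>n. ennreal (b n)) \<longlonglongrightarrow> ennreal 0" by (intro tendsto_ennrealI) simp
    then show ?thesis by simp
  qed
  show "(\<lambda>n. outer_measure_of M {\<omega> \<in> space M. ?S n \<omega> > ennreal \<epsilon>}) \<longlonglongrightarrow> 0"
    by (rule tendsto_sandwich[OF _ bound tendsto_const lim]) simp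
qed

theorem mainTheorem3:
  fixes \<alpha> c :: real
    and P :: "(real ^ 'n) measure"
    and M :: "'w measure"
    and X :: "nat \<Rightarrow> 'w \<Rightarrow> real ^ 'n"
  assumes "0 < \<alpha>" and "\<alpha> < 1" and "0 < c"
    and c: "\<And>(R :: (real ^ 'n) measure) n. prob_space R \<Longrightarrow> sets R = sets borel \<Longrightarrow> n \<ge> 1 \<Longrightarrow>
      outer_measure_of (\<Pi>\<^sub>M i\<in>{..<n}. R)
        {x \<in> space (\<Pi>\<^sub>M i\<in>{..<n}. R).
           halfspace_dist (empirical_distribution n x) R \<ge> c / sqrt (real n)} \<le> ennreal \<alpha>"
    and P: "P \<in> log_concave_distributions"
    and M: "prob_space M"
    and indep: "prob_space.indep_vars M (\<lambda>_. borel) X UNIV"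
    and distr: "\<And>i. distr M borel (X i) = P"
  shows "(\<forall>n\<ge>1. inner_measure_of M
            {\<omega> \<in> space M. \<forall>p. real_polynomial_function p \<longrightarrow>
               (\<integral>y. p y \<partial>P) \<in> integral_confidence_set c n (\<lambda>i. X i \<omega>) p} \<ge> ennreal (1 - \<alpha>))
       \<and> (\<forall>p. real_polynomial_function p \<longrightarrow>
            tends_to_0_in_outer_prob M
              (\<lambda>n \<omega>. SUP t\<in>integral_confidence_set c n (\<lambda>i. X i \<omega>) p.
                         ennreal \<bar>t - (\<integral>y. p y \<partial>P)\<bar>))"
proof (intro conjI allI impI)
  fix n :: nat assume n: "n \<ge> 1"
  obtain B where B: "B \<in> sets M" "emeasure M B \<ge> ennreal (1 - \<alpha>)"
    "\<And>\<omega>. \<omega> \<in> B \<Longrightarrow> P \<in> confidence_set c n (\<lambda>i. X i \<omega>)"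
    using confidence_set_coverage[OF c[OF log_concave_distributions_prob_space(1,2)[OF P] n] _ P M indep distr n]
      \<open>0 < \<alpha>\<close> by (auto intro: less_imp_le)
  let ?G = "{\<omega> \<in> space M. \<forall>p. real_polynomial_function p \<longrightarrow>
    (\<integral>y. p y \<partial>P) \<in> integral_confidence_set c n (\<lambda>i. X i \<omega>) p}"
  \<comment> \<open>The witness is \<open>Q = P\<close> for every polynomial at once.\<close>
  have "B \<subseteq> ?G"
    using B(3) sets.sets_into_space[OF B(1)] by (auto simp: integral_confidence_set_def)
  then have "emeasure M B \<le> inner_measure_of M ?G"
    unfolding inner_measure_of_def using B(1) by (intro SUP_upper) auto
  with B(2) show "inner_measure_of M ?G \<ge> ennreal (1 - \<alpha>)" by (rule order_trans)
qed (rule integral_confidence_set_consistent[OF P M indep distr])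

end
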